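(* For every integer $c\ge 1$ there is a constant $\delta(c)$ such that for every integer $\ell\ge 1$ \[ k^*(P_\ell,P_c)=(\delta(c)-o(1))\cdot \ell, \] where $o(1)$ stands for a non-negative function of $c$ and $\ell$ that tends to $0$ for $c$ fixed and $\ell\to\infty$.
   Context: For a positive integer $k$ and forests $F_1,F_2$, the $(F_1,F_2)$-avoidance game with tree size restriction $k$ is played by Builder and Painter on a vertex-colored graph (the board), initially empty. In each step Builder adds one new vertex with edges from some previously present vertices to it, so that the board always remains a forest all of whose components have at most $k$ vertices; Painter immediately and irrevocably colors the new vertex with color $1$ or $2$. Painter loses as soon as the board contains a copy (subgraph isomorphic) of $F_1$ all of whose vertices have color $1$ or a copy of $F_2$ all of whose vertices have color $2$. Builder has a winning strategy if he can force this within finitely many steps. $k^*(F_1,F_2)$ is the smallest $k$ for which Builder has a winning strategy. $P_\ell$ denotes the path on $\ell$ vertices. *)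

theory Defs
  imports Complex_Main "HOL-Library.Extended_Real"
begin

record 'a graph =
  verts :: "'a set"
  edges :: "'a set set"

definition simple_graph :: "('a, 'b) graph_scheme \<Rightarrow> bool" where
  "simple_graph G \<longleftrightarrow> (\<forall>e\<in>edges G. e \<subseteq> verts G \<and> card e = 2)"

definition is_cycle :: "('a, 'b) graph_scheme \<Rightarrow> 'a list \<Rightarrow> bool" where
  "is_cycle G p \<longleftrightarrow> 3 \<le> length p \<and> distinct p \<and>
     (\<forall>i<length p. {p ! i, p ! (Suc i mod length p)} \<in> edges G)"

definition forest :: "('a, 'b) graph_scheme \<Rightarrow> bool" where
  "forest G \<longleftrightarrow> simple_graph G \<and> (\<nexists>p. is_cycle G p)"

definition adjacent :: "('a, 'b) graph_scheme \<Rightarrow> 'a \<Rightarrow> 'a \<Rightarrow> bool" where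
  "adjacent G u v \<longleftrightarrow> {u, v} \<in> edges G"

definition component :: "('a, 'b) graph_scheme \<Rightarrow> 'a \<Rightarrow> 'a set" where
  "component G v = {u \<in> verts G. (adjacent G)\<^sup>*\<^sup>* v u}"

definition path_graph :: "nat \<Rightarrow> nat graph" where
  "path_graph n = \<lparr>verts = {..<n}, edges = {{i, Suc i} |i. Suc i < n}\<rparr>"

text \<open>Colours are the numbers 1 and 2; \<open>colour B\<close> is only meaningful on \<open>verts B\<close>.\<close>

record 'a board = "'a graph" +
  colour :: "'a \<Rightarrow> nat"

definition empty_board :: "'a board" where
  "empty_board = \<lparr>verts = {}, edges = {}, colour = (\<lambda>_. 0)\<rparr>"

definition add_vertex :: "'a board \<Rightarrow> 'a \<Rightarrow> 'a set \<Rightarrow> nat \<Rightarrow> 'a board" where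
  "add_vertex B v N c =
     \<lparr>verts = insert v (verts B),
      edges = edges B \<union> {{u, v} |u. u \<in> N},
      colour = (colour B)(v := c)\<rparr>"

text \<open>Copies are not required to be induced.\<close>

definition mono_copy :: "'f graph \<Rightarrow> nat \<Rightarrow> 'a board \<Rightarrow> bool" where
  "mono_copy F c B \<longleftrightarrow>
     (\<exists>f. inj_on f (verts F) \<and> f ` verts F \<subseteq> {v \<in> verts B. colour B v = c} \<and>
          (\<forall>e\<in>edges F. f ` e \<in> edges B))"

definition painter_lost :: "'f graph \<Rightarrow> 'g graph \<Rightarrow> 'a board \<Rightarrow> bool" where
  "painter_lost F1 F2 B \<longleftrightarrow> mono_copy F1 1 B \<or> mono_copy F2 2 B"

text \<open>Whether a move is legal does not depend on the colour of the new vertex, so the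
  colour 1 below is arbitrary.\<close>

definition legal_move :: "nat \<Rightarrow> 'a board \<Rightarrow> 'a \<Rightarrow> 'a set \<Rightarrow> bool" where
  "legal_move k B v N \<longleftrightarrow> v \<notin> verts B \<and> N \<subseteq> verts B \<and>
     (let B' = add_vertex B v N 1
      in forest B' \<and> (\<forall>w\<in>verts B'. card (component B' w) \<le> k))"

text \<open>\<open>builder_forces k F1 F2 n B\<close>: starting from \<open>B\<close>, Builder can make Painter lose
  within at most \<open>n\<close> further steps, whatever colours Painter uses.\<close>

primrec builder_forces ::
  "nat \<Rightarrow> 'f graph \<Rightarrow> 'g graph \<Rightarrow> nat \<Rightarrow> 'a board \<Rightarrow> bool" where
  "builder_forces k F1 F2 0 B \<longleftrightarrow> painter_lost F1 F2 B"
| "builder_forces k F1 F2 (Suc n) B \<longleftrightarrow> painter_lost F1 F2 B \<or>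
     (\<exists>v N. legal_move k B v N \<and>
        (\<forall>c\<in>{1, 2}. builder_forces k F1 F2 n (add_vertex B v N c)))"

definition builder_wins :: "nat \<Rightarrow> 'f graph \<Rightarrow> 'g graph \<Rightarrow> bool" where
  "builder_wins k F1 F2 \<longleftrightarrow>
     (\<exists>n. builder_forces k F1 F2 n (empty_board :: nat board))"

text \<open>The infimum is a minimum when Builder wins for some \<open>k\<close>, and \<open>\<infinity>\<close> otherwise.\<close>

definition kstar :: "'f graph \<Rightarrow> 'g graph \<Rightarrow> enat" where
  "kstar F1 F2 = (INF k \<in> {k. 1 \<le> k \<and> builder_wins k F1 F2}. enat k)"

end

theory Submission
  imports Defs "HOL-Library.Multiset"
begin

text \<open>
  Call colour 1 red and colour 2 blue. The game reduces to a one-dimensional scheduling problem.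
  Suppose Builder can already force red paths on \<open>a < p\<close> vertices in components of size
  \<open>rs ! a\<close>, and blue paths on \<open>j < q\<close> vertices in components of size \<open>bs ! j\<close>. A new vertex
  joined to the ends of the two cheapest red paths with \<open>p - 1\<close> vertices in total, and to the ends
  of the two cheapest blue paths with \<open>q - 1\<close> vertices in total, closes a red \<open>P\<^sub>p\<close> or a blue
  \<open>P\<^sub>q\<close> at a cost that depends only on the current state; Painter decides which of the two
  prices becomes known next. Builder can realise every such step arbitrarily often by pigeonhole.
  Conversely, Painter can fix a sequence of decisions in advance and read it as a priority list: a
  new vertex gets the colour whose longest path through it comes first in the list. Hence
  \<open>k\<^sup>*(P\<^sub>l, P\<^sub>c)\<close> is the maximal cost over all sequences of decisions.

  Once only the red decision remains, each further price is \<open>D\<close> plus the cheapest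
  split, with \<open>D\<close> constant. So if \<open>rs ! i + D \<ge> \<rho> (i + 1)\<close> holds for all known prices, it continues to
  hold for ever. The limit \<open>\<delta>(c)\<close> is the supremum of these slopes \<open>\<rho>\<close>. An optimal sequence of
  decisions for \<open>l\<close> either has slope at least \<open>k\<^sup>*/l\<close> itself, or it can be split so as to
  exhibit a shorter red path with a worse ratio; by induction \<open>k\<^sup>* \<le> \<delta>(c) l\<close>.
\<close>

section \<open>The scheduling problem\<close>

text \<open>This is the (min,+)-convolution of \<open>xs\<close> with itself at
  \<open>n - 1\<close>: the vertex that joins the two paths supplies the missing one of the
  \<open>n\<close> vertices. It is meant for \<open>n\<close> between 1 and
  \<open>length xs\<close>.\<close>

definition msum :: "nat list \<Rightarrow> nat \<Rightarrow> nat" where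
  "msum xs n = Min ((\<lambda>i. xs ! i + xs ! (n - 1 - i)) ` {..<n})"

lemma msum_le: "a + b + 1 = n \<Longrightarrow> msum xs n \<le> xs ! a + xs ! b"
  unfolding msum_def by (rule Min_le) (auto intro!: image_eqI[of _ _ a])

lemma msum_attained:
  assumes "1 \<le> n"
  obtains a b where "a + b + 1 = n" "msum xs n = xs ! a + xs ! b"
proof -
  have "msum xs n \<in> (\<lambda>i. xs ! i + xs ! (n - 1 - i)) ` {..<n}"
    unfolding msum_def using assms by (intro Min_in) (auto simp: lessThan_empty_iff)
  then obtain i where "i < n" "msum xs n = xs ! i + xs ! (n - 1 - i)" by auto
  then show ?thesis using that[of i "n - 1 - i"] by auto
qed

lemma msum_append:
  assumes "n \<le> length xs"
  shows "msum (xs @ ys) n = msum xs n"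
proof -
  have "(\<lambda>i. (xs @ ys) ! i + (xs @ ys) ! (n - 1 - i)) ` {..<n} =
        (\<lambda>i. xs ! i + xs ! (n - 1 - i)) ` {..<n}"
    using assms by (intro image_cong) (auto simp: nth_append)
  then show ?thesis by (simp add: msum_def)
qed

text \<open>When the joined path is longer than the next one to be priced, the second piece can be
  shortened to fit, and sortedness says that this costs no more. Painter needs this because paths
  offered by Builder may overshoot the lists.\<close>

lemma msum_min_length_le:
  assumes "sorted xs" "a < length xs" "b < length xs"
  shows "msum xs (min (a + b + 1) (length xs)) \<le> xs ! a + xs ! b"
proof (cases "a + b + 1 \<le> length xs")
  case True
  then show ?thesis by (simp add: msum_le min_def)
next
  case False
  then have "msum xs (length xs) \<le> xs ! a + xs ! (length xs - 1 - a)"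
    using assms by (intro msum_le) auto
  also have "xs ! (length xs - 1 - a) \<le> xs ! b"
    using False assms by (intro sorted_nth_mono) auto
  finally show ?thesis using False by (simp add: min_def)
qed

text \<open>An optimal split for \<open>n\<close> truncates to a split for \<open>m\<close> with
  neither piece longer than before.\<close>

lemma msum_mono:
  assumes "sorted xs" "1 \<le> m" "m \<le> n" "n \<le> length xs"
  shows "msum xs m \<le> msum xs n"
proof -
  obtain a b where ab: "a + b + 1 = n" "msum xs n = xs ! a + xs ! b"
    using msum_attained[of n xs] assms by auto
  define a' where "a' = min a (m - 1)"
  have "msum xs m \<le> xs ! a' + xs ! (m - 1 - a')"
    using assms by (intro msum_le) (auto simp: a'_def)
  also have "xs ! a' \<le> xs ! a"
    using assms ab by (intro sorted_nth_mono) (auto simp: a'_def)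
  also have "xs ! (m - 1 - a') \<le> xs ! b"
    using assms ab by (intro sorted_nth_mono) (auto simp: a'_def)
  finally show ?thesis using ab by simp
qed

section \<open>Price lists arising from sequences of decisions\<close>

definition cost :: "nat list \<Rightarrow> nat list \<Rightarrow> nat" where
  "cost rs bs = 1 + msum rs (length rs) + msum bs (length bs)"

text \<open>\<open>rs ! a\<close> is the price of a red path on \<open>a\<close> vertices; the entry 0 is the empty path. The next
  path to be priced in each colour is the one whose number of vertices is the length of the list.\<close>

inductive reach :: "nat list \<Rightarrow> nat list \<Rightarrow> bool" where
  start: "reach [0] [0]"
| red: "reach rs bs \<Longrightarrow> reach (rs @ [cost rs bs]) bs"
| blue: "reach rs bs \<Longrightarrow> reach rs (bs @ [cost rs bs])"

lemma reach_length: "reach rs bs \<Longrightarrow> 1 \<le> length rs \<and> 1 \<le> length bs"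
  by (induction rule: reach.induct) auto

lemma reach_nth_0: "reach rs bs \<Longrightarrow> rs ! 0 = 0 \<and> bs ! 0 = 0"
proof (induction rule: reach.induct)
  case (red rs bs)
  then show ?case using reach_length[OF red.hyps] by (auto simp: nth_append)
next
  case (blue rs bs)
  then show ?case using reach_length[OF blue.hyps] by (auto simp: nth_append)
qed simp

lemma msum_le_append:
  assumes "sorted (xs @ [x])" "1 \<le> length xs"
  shows "msum xs (length xs) \<le> msum (xs @ [x]) (Suc (length xs))"
  using msum_mono[of "xs @ [x]" "length xs" "Suc (length xs)"] assms by (simp add: msum_append)

text \<open>The claims depend on each other: appending a price keeps a list sorted only if that
  price bounds all earlier ones, and the next price dominates the last one only because
  \<open>msum\<close> is monotone on the sorted extended list.\<close>

lemma reach_sorted_bounded: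
  "reach rs bs \<Longrightarrow> sorted rs \<and> sorted bs \<and> (\<forall>x \<in> set rs \<union> set bs. x \<le> cost rs bs)"
proof (induction rule: reach.induct)
  case start
  then show ?case by auto
next
  case (red rs bs)
  let ?K = "cost rs bs"
  have s: "sorted (rs @ [?K])" using red.IH by (auto simp: sorted_append)
  have "?K \<le> cost (rs @ [?K]) bs"
    using msum_le_append[OF s] reach_length[OF red.hyps] by (simp add: cost_def)
  then show ?case using red.IH s by (auto dest: order_trans)
next
  case (blue rs bs)
  let ?K = "cost rs bs"
  have s: "sorted (bs @ [?K])" using blue.IH by (auto simp: sorted_append)
  have "?K \<le> cost rs (bs @ [?K])"
    using msum_le_append[OF s] reach_length[OF blue.hyps] by (simp add: cost_def)
  then show ?case using blue.IH s by (auto dest: order_trans)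
qed

lemma reach_sorted: "reach rs bs \<Longrightarrow> sorted rs" "reach rs bs \<Longrightarrow> sorted bs"
  using reach_sorted_bounded by blast+

lemma cost_red_mono: "reach rs bs \<Longrightarrow> cost rs bs \<le> cost (rs @ [cost rs bs]) bs"
  using reach_sorted_bounded[OF reach.red] by auto

lemma cost_blue_mono: "reach rs bs \<Longrightarrow> cost rs bs \<le> cost rs (bs @ [cost rs bs])"
  using reach_sorted_bounded[OF reach.blue] by auto

text \<open>Whichever of a red path on \<open>a\<close> and a blue path on \<open>j\<close> vertices is priced first along the
  sequence of decisions is priced against a competitor that is no longer than the other path.\<close>

lemma reach_priority:
  assumes "reach rs bs" "1 \<le> a" "a \<le> length rs" "1 \<le> j" "j \<le> length bs"
    "a < length rs \<or> j < length bs"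
  shows "a < length rs \<and> rs ! a \<le> 1 + msum rs a + msum bs j \<or>
         j < length bs \<and> bs ! j \<le> 1 + msum rs a + msum bs j"
  using assms
proof (induction arbitrary: a j rule: reach.induct)
  case start
  then show ?case by auto
next
  case (red rs bs)
  let ?K = "cost rs bs"
  have s: "sorted (rs @ [?K])" using reach_sorted(1)[OF reach.red[OF red.hyps]] .
  consider "a \<le> length rs" "a < length rs \<or> j < length bs"
    | "a = length rs" "j = length bs" | "a = Suc (length rs)" "j < length bs"
    using red.prems by fastforce
  then show ?case
  proof cases
    case 1
    then show ?thesis using red.IH[of a j] red.prems by (auto simp: msum_append nth_append)
  next
    case 2
    then show ?thesis by (simp add: msum_append cost_def)
  next
    case 3
    \<comment> \<open>Here red was priced last, so the induction hypothesis at
      \<open>a = length rs\<close> leaves only its blue alternative; the longer red competitor can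
      only raise the right-hand side.\<close>
    have "bs ! j \<le> 1 + msum rs (length rs) + msum bs j"
      using red.IH[of "length rs" j] 3 red.prems reach_length[OF red.hyps] by auto
    then show ?thesis using msum_le_append[OF s] reach_length[OF red.hyps] 3 by auto
  qed
next
  case (blue rs bs)
  let ?K = "cost rs bs"
  have s: "sorted (bs @ [?K])" using reach_sorted(2)[OF reach.blue[OF blue.hyps]] .
  consider "j \<le> length bs" "a < length rs \<or> j < length bs"
    | "a = length rs" "j = length bs" | "j = Suc (length bs)" "a < length rs"
    using blue.prems by fastforce
  then show ?case
  proof cases
    case 1
    then show ?thesis using blue.IH[of a j] blue.prems by (auto simp: msum_append nth_append)
  next
    case 2
    then show ?thesis by (simp add: msum_append cost_def)
  next
    case 3
    have "rs ! a \<le> 1 + msum rs a + msum bs (length bs)"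
      using blue.IH[of a "length bs"] 3 blue.prems reach_length[OF blue.hyps] by auto
    then show ?thesis using msum_le_append[OF s] reach_length[OF blue.hyps] 3 by auto
  qed
qed

text \<open>Going back to the moment at which the red path was priced exhibits its price as the cost
  of an earlier state, hence as a lower bound for the game value at \<open>i\<close>.\<close>

lemma reach_red_origin:
  assumes "reach rs bs" "1 \<le> i" "i < length rs"
  shows "\<exists>rs' bs'. reach rs' bs' \<and> length rs' = i \<and> length bs' \<le> length bs \<and> rs ! i = cost rs' bs'"
  using assms
proof (induction rule: reach.induct)
  case (red rs bs)
  then show ?case
    by (cases "i = length rs") (auto simp: nth_append)
next
  case (blue rs bs)
  then show ?case by fastforce
qed auto

text \<open>Since costs never decrease along decisions, a maximal cost may be sought among lists of
  full length; the blue analogue follows.\<close>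

lemma reach_red_extend:
  assumes "reach rs bs" "length rs \<le> l"
  shows "\<exists>rs'. reach rs' bs \<and> length rs' = l \<and> cost rs bs \<le> cost rs' bs"
  using assms(2)
proof (induction l rule: dec_induct)
  case base
  then show ?case using assms by blast
next
  case (step n)
  then show ?case using cost_red_mono reach.red by (metis length_append_singleton order_trans)
qed

lemma reach_blue_extend:
  assumes "reach rs bs" "length bs \<le> c"
  shows "\<exists>bs'. reach rs bs' \<and> length bs' = c \<and> cost rs bs \<le> cost rs bs'"
  using assms(2)
proof (induction c rule: dec_induct)
  case base
  then show ?case using assms by blast
next
  case (step n)
  then show ?case using cost_blue_mono reach.blue by (metis length_append_singleton order_trans)
qed

text \<open>Each additional blue price at most doubles the price per red vertex and adds one, which
  gives the rate \<open>2 ^ q - 1\<close> for \<open>q\<close> blue entries.\<close>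

lemma cost_le_linear:
  assumes "reach rs bs"
  shows "cost rs bs \<le> 2 ^ length bs * length rs"
proof -
  define \<kappa> :: "nat \<Rightarrow> nat" where "\<kappa> q = 2 ^ q - 1" for q
  have \<kappa>_Suc: "\<kappa> (Suc q) = 2 * \<kappa> q + 1" for q
    unfolding \<kappa>_def power_Suc using one_le_power[of "2::nat" q] by linarith
  have step: "cost rs bs \<le> k * length rs"
    if "1 \<le> t" "t \<le> length rs" "1 + msum bs (length bs) + rs ! (t - 1) \<le> k * t"
      "\<forall>i<length rs. rs ! i \<le> k * i" for rs bs k t
  proof -
    \<comment> \<open>One piece with \<open>t - 1\<close> vertices, together with the new vertex and
      the blue overhead, costs at most \<open>k * t\<close>; the other piece has
      \<open>length rs - t\<close> vertices and obeys the rate by assumption.\<close>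
    have "msum rs (length rs) \<le> rs ! (t - 1) + rs ! (length rs - t)"
      using that by (intro msum_le) auto
    moreover have "rs ! (length rs - t) \<le> k * (length rs - t)" using that by auto
    ultimately have "cost rs bs \<le> k * t + k * (length rs - t)"
      using that(3) unfolding cost_def by linarith
    also have "\<dots> = k * length rs" using that by (simp flip: distrib_left)
    finally show ?thesis .
  qed
  \<comment> \<open>The witness \<open>t\<close> is the number of red vertices over which the blue
    overhead is amortised. It survives red decisions and is reset to \<open>length rs\<close> at
    each blue one.\<close>
  have "\<exists>t. 1 \<le> t \<and> t \<le> length rs \<and> 1 + msum bs (length bs) + rs ! (t - 1) \<le> \<kappa> (length bs) * t
     \<and> (\<forall>i<length rs. rs ! i \<le> \<kappa> (length bs) * i)"
    using assms
  proof (induction rule: reach.induct)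
    case start
    then show ?case by (intro exI[of _ 1]) (auto simp: msum_def \<kappa>_def lessThan_Suc)
  next
    case (red rs bs)
    then obtain t where t: "1 \<le> t" "t \<le> length rs"
      "1 + msum bs (length bs) + rs ! (t - 1) \<le> \<kappa> (length bs) * t"
      "\<forall>i<length rs. rs ! i \<le> \<kappa> (length bs) * i" by blast
    have "cost rs bs \<le> \<kappa> (length bs) * length rs" using step t by blast
    with t show ?case by (intro exI[of _ t]) (auto simp: nth_append less_Suc_eq)
  next
    case (blue rs bs)
    then obtain t where t: "1 \<le> t" "t \<le> length rs"
      "1 + msum bs (length bs) + rs ! (t - 1) \<le> \<kappa> (length bs) * t"
      "\<forall>i<length rs. rs ! i \<le> \<kappa> (length bs) * i" by blast
    let ?K = "cost rs bs" and ?k = "\<kappa> (length bs)" and ?p = "length rs"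
    have K: "?K \<le> ?k * ?p" using step t by blast
    \<comment> \<open>Pairing the new blue path with the empty one bounds the new blue overhead by
      \<open>?K\<close>.\<close>
    have "msum (bs @ [?K]) (Suc (length bs)) \<le> (bs @ [?K]) ! length bs + (bs @ [?K]) ! 0"
      by (intro msum_le) auto
    then have m: "msum (bs @ [?K]) (Suc (length bs)) \<le> ?K"
      using reach_nth_0[OF reach.blue[OF blue.hyps]] by simp
    have p: "1 \<le> ?p" using reach_length[OF blue.hyps] by simp
    then have "rs ! (?p - 1) \<le> ?k * (?p - 1)" using t(4) by auto
    also have "\<dots> \<le> ?k * ?p" by simp
    finally have "1 + msum (bs @ [?K]) (Suc (length bs)) + rs ! (?p - 1) \<le> 1 + ?k * ?p + ?k * ?p"
      using m K by linarith
    also have "\<dots> \<le> (2 * ?k + 1) * ?p" using p by (simp add: algebra_simps)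
    finally have *: "1 + msum (bs @ [?K]) (Suc (length bs)) + rs ! (?p - 1) \<le> \<kappa> (Suc (length bs)) * ?p"
      by (simp add: \<kappa>_Suc)
    have "rs ! i \<le> \<kappa> (Suc (length bs)) * i" if "i < ?p" for i
    proof -
      have "rs ! i \<le> ?k * i" using t(4) that by blast
      also have "\<dots> \<le> \<kappa> (Suc (length bs)) * i" unfolding \<kappa>_Suc by (intro mult_right_mono) auto
      finally show ?thesis .
    qed
    with * p show ?case by (intro exI[of _ ?p]) auto
  qed
  then have "cost rs bs \<le> \<kappa> (length bs) * length rs" using step by blast
  also have "\<dots> \<le> 2 ^ length bs * length rs" by (simp add: \<kappa>_def)
  finally show ?thesis .
qed

section \<open>Asymptotics\<close>

text \<open>Inequalities on the lengths allow states with a shorter blue list to be compared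
  directly; \<open>game_value_attained\<close> shows that full lengths attain the maximum.\<close>

definition game_value :: "nat \<Rightarrow> nat \<Rightarrow> nat" where
  "game_value l c = Max {cost rs bs |rs bs. reach rs bs \<and> length rs \<le> l \<and> length bs \<le> c}"

lemma cost_le_bound:
  assumes "reach rs bs" "length rs \<le> l" "length bs \<le> c"
  shows "cost rs bs \<le> 2 ^ c * l"
proof -
  have "cost rs bs \<le> 2 ^ length bs * length rs" using assms cost_le_linear by blast
  also have "\<dots> \<le> 2 ^ c * l" using assms by (intro mult_mono power_increasing) auto
  finally show ?thesis .
qed

lemma finite_costs: "finite {cost rs bs |rs bs. reach rs bs \<and> length rs \<le> l \<and> length bs \<le> c}"
proof (rule finite_subset)
  show "{cost rs bs |rs bs. reach rs bs \<and> length rs \<le> l \<and> length bs \<le> c} \<subseteq> {..2 ^ c * l}"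
    using cost_le_bound by blast
qed simp

lemma cost_le_game_value:
  "reach rs bs \<Longrightarrow> length rs \<le> l \<Longrightarrow> length bs \<le> c \<Longrightarrow> cost rs bs \<le> game_value l c"
  unfolding game_value_def by (intro Max_ge finite_costs) blast

lemma game_value_attained:
  assumes "1 \<le> l" "1 \<le> c"
  obtains rs bs where "reach rs bs" "length rs = l" "length bs = c" "game_value l c = cost rs bs"
proof -
  let ?S = "{cost rs bs |rs bs. reach rs bs \<and> length rs \<le> l \<and> length bs \<le> c}"
  have "cost [0] [0] \<in> ?S" using assms reach.start by force
  then have "game_value l c \<in> ?S"
    unfolding game_value_def using finite_costs by (intro Max_in) auto
  then obtain rs bs where 1: "reach rs bs" "length rs \<le> l" "length bs \<le> c" "game_value l c = cost rs bs"
    by auto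
  then obtain rs' where 2: "reach rs' bs" "length rs' = l" "cost rs bs \<le> cost rs' bs"
    using reach_red_extend by blast
  then obtain bs' where 3: "reach rs' bs'" "length bs' = c" "cost rs' bs \<le> cost rs' bs'"
    using reach_blue_extend 1 by blast
  then have "game_value l c = cost rs' bs'"
    using 1 2 cost_le_game_value[of rs' bs' l c] by simp
  then show ?thesis using 2 3 that by blast
qed

text \<open>For lists \<open>bs\<close> of length \<open>c\<close> all affordable blue paths are priced, so that \<open>1 + msum bs c\<close> is the
  constant overhead of each further red price.\<close>

definition slopes :: "nat \<Rightarrow> real set" where
  "slopes c = {\<rho>. \<exists>rs bs. reach rs bs \<and> length bs = c \<and>
     (\<forall>i<length rs. \<rho> * (real i + 1) \<le> real (rs ! i) + (1 + real (msum bs c)))}"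

text \<open>Put \<open>f i = rs ! i + D\<close>. A further red price satisfies
  \<open>f n = f a + f b\<close> for an optimal split, where
  \<open>(a + 1) + (b + 1) = n + 1\<close>. So the bound \<open>f i \<ge> \<rho> * (i + 1)\<close>
  reproduces itself, which explains the shift by one in \<open>slopes\<close>.\<close>

lemma slope_lower:
  assumes "\<rho> \<in> slopes c"
  obtains D L where "\<And>l. L \<le> l \<Longrightarrow> \<rho> * (real l + 1) \<le> real (game_value l c) + D"
proof -
  obtain rs bs where rb: "reach rs bs" "length bs = c"
    "\<forall>i<length rs. \<rho> * (real i + 1) \<le> real (rs ! i) + (1 + real (msum bs c))"
    using assms unfolding slopes_def by blast
  define D where "D = 1 + real (msum bs c)"
  have cost_ge: "\<rho> * (real (length rs') + 1) \<le> real (cost rs' bs) + D"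
    if "reach rs' bs" "\<forall>i<length rs'. \<rho> * (real i + 1) \<le> real (rs' ! i) + D" for rs'
  proof -
    have "1 \<le> length rs'" using reach_length[OF that(1)] by simp
    then obtain a b where ab: "a + b + 1 = length rs'" "msum rs' (length rs') = rs' ! a + rs' ! b"
      by (rule msum_attained)
    have "\<rho> * (real (length rs') + 1) = \<rho> * (real a + 1) + \<rho> * (real b + 1)"
      unfolding ab(1)[symmetric] by (simp add: algebra_simps)
    also have "\<dots> \<le> (real (rs' ! a) + D) + (real (rs' ! b) + D)"
      using that(2) ab(1) by (intro add_mono) auto
    also have "\<dots> = real (cost rs' bs) + D"
      using ab(2) rb(2) by (simp add: cost_def D_def)
    finally show ?thesis .
  qed
  have "\<exists>rs'. reach rs' bs \<and> length rs' = l \<and>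
      (\<forall>i<length rs'. \<rho> * (real i + 1) \<le> real (rs' ! i) + D)" if "length rs \<le> l" for l
    using that
  proof (induction l rule: dec_induct)
    case base
    then show ?case using rb D_def by blast
  next
    case (step n)
    then obtain rs' where rs': "reach rs' bs" "length rs' = n"
      "\<forall>i<length rs'. \<rho> * (real i + 1) \<le> real (rs' ! i) + D" by blast
    then show ?case using cost_ge[OF rs'(1,3)]
      by (intro exI[of _ "rs' @ [cost rs' bs]"])
        (auto simp: nth_append less_Suc_eq intro: reach.red)
  qed
  note ext = this
  have "\<rho> * (real l + 1) \<le> real (game_value l c) + D" if l: "length rs \<le> l" for l
  proof -
    obtain rs' where rs': "reach rs' bs" "length rs' = l"
      "\<forall>i<length rs'. \<rho> * (real i + 1) \<le> real (rs' ! i) + D"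
      using ext[OF l] by blast
    then have "cost rs' bs \<le> game_value l c" using rb(2) by (intro cost_le_game_value) auto
    then show ?thesis using cost_ge[OF rs'(1,3)] rs'(2) by simp
  qed
  then show ?thesis using that by blast
qed

lemma game_value_le_slope:
  assumes "1 \<le> c" "1 \<le> l"
  shows "\<exists>\<rho>\<in>slopes c. real (game_value l c) \<le> \<rho> * real l"
  using assms(2)
proof (induction l rule: less_induct)
  case (less l)
  obtain rs bs where rb: "reach rs bs" "length rs = l" "length bs = c" "game_value l c = cost rs bs"
    using game_value_attained assms less.prems by blast
  define D where "D = 1 + real (msum bs c)"
  define \<rho> where "\<rho> = real (game_value l c) / real l"
  have V: "real (game_value l c) = \<rho> * real l" using less.prems by (simp add: \<rho>_def)
  have V': "real (game_value l c) = real (msum rs l) + D"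
    using rb by (simp add: cost_def D_def)
  show ?case
  proof (cases "\<forall>i<l. \<rho> * (real i + 1) \<le> real (rs ! i) + D")
    case True
    then have "\<rho> \<in> slopes c" using rb unfolding slopes_def D_def by blast
    then show ?thesis using V by auto
  next
    case False
    then obtain i where i: "i < l" "real (rs ! i) + D < \<rho> * (real i + 1)" by force
    \<comment> \<open>At \<open>i\<close> the price is too low for slope \<open>\<rho>\<close>, so
      the complementary piece, with \<open>m < l\<close> vertices, must be too expensive: its ratio
      exceeds \<open>\<rho>\<close>, and the induction hypothesis for \<open>m\<close> supplies a
      slope that is larger still.\<close>
    define m where "m = l - 1 - i"
    have m: "i + m + 1 = l" using i by (simp add: m_def)
    have "msum rs l \<le> rs ! i + rs ! m" using m by (rule msum_le)
    then have "\<rho> * real l < \<rho> * (real i + 1) + real (rs ! m)"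
      using i V V' by linarith
    then have lt: "\<rho> * real m < real (rs ! m)"
      unfolding m[symmetric] by (simp add: algebra_simps)
    \<comment> \<open>The piece is not empty because the empty path costs 0.\<close>
    then have m1: "1 \<le> m" using reach_nth_0[OF rb(1)] by (cases m) auto
    then obtain rs' bs' where o: "reach rs' bs'" "length rs' = m" "length bs' \<le> c" "rs ! m = cost rs' bs'"
      using reach_red_origin[OF rb(1), of m] rb m by auto
    then have "rs ! m \<le> game_value m c" using cost_le_game_value by simp
    moreover obtain \<rho>' where \<rho>': "\<rho>' \<in> slopes c" "real (game_value m c) \<le> \<rho>' * real m"
      using less.IH[of m] m m1 by auto
    ultimately have "\<rho> * real m < \<rho>' * real m" using lt by linarith
    then have "\<rho> * real l \<le> \<rho>' * real l" using m1 by (intro mult_right_mono) auto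
    then show ?thesis using \<rho>'(1) V by auto
  qed
qed

text \<open>A slope above \<open>2 ^ c\<close> would force the game value past its linear bound once
  \<open>l\<close> is large enough to absorb the constant \<open>D\<close>. This makes the supremum
  of the slopes meaningful.\<close>

lemma slopes_le:
  assumes "1 \<le> c" "\<rho> \<in> slopes c"
  shows "\<rho> \<le> 2 ^ c"
proof (rule ccontr)
  assume neg: "\<not> \<rho> \<le> 2 ^ c"
  obtain D L where DL: "\<And>l. L \<le> l \<Longrightarrow> \<rho> * (real l + 1) \<le> real (game_value l c) + D"
    by (rule slope_lower[OF assms(2)]) blast
  obtain n :: nat where n: "D < real n * (\<rho> - 2 ^ c)"
    using ex_less_of_nat_mult[of "\<rho> - 2 ^ c" D] neg unfolding not_le diff_gt_0_iff_gt by blast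
  define l where "l = max (max n L) 1"
  have l: "1 \<le> l" "n \<le> l" "L \<le> l" by (auto simp: l_def)
  obtain rs bs where "reach rs bs" "length rs = l" "length bs = c" "game_value l c = cost rs bs"
    using game_value_attained assms l by blast
  then have "game_value l c \<le> 2 ^ c * l" using cost_le_bound by auto
  then have "real (game_value l c) \<le> real (2 ^ c * l)" by (rule of_nat_mono)
  then have "(\<rho> - 2 ^ c) * real l + \<rho> \<le> D" using DL[OF l(3)] by (simp add: algebra_simps)
  moreover have "real n * (\<rho> - 2 ^ c) \<le> (\<rho> - 2 ^ c) * real l"
    using neg l by (simp add: mult.commute mult_right_mono)
  moreover have "(0::real) < 2 ^ c" by simp
  ultimately show False using n neg by linarith
qed

text \<open>The constant is the supremum of the slopes: \<open>game_value_le_slope\<close> bounds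
  the ratio by it for every \<open>l\<close>, and \<open>slope_lower\<close> pushes the ratio
  eventually above anything smaller.\<close>

lemma game_value_asymptotics:
  assumes "1 \<le> c"
  shows "\<exists>\<delta>. (\<forall>l\<ge>1. real (game_value l c) \<le> \<delta> * real l) \<and>
    (\<lambda>l. \<delta> - real (game_value l c) / real l) \<longlonglongrightarrow> 0"
proof -
  define \<delta> where "\<delta> = Sup (slopes c)"
  have bdd: "bdd_above (slopes c)" using slopes_le assms by (intro bdd_aboveI) blast
  have ub: "real (game_value l c) \<le> \<delta> * real l" if l: "1 \<le> l" for l
  proof -
    obtain \<rho> where "\<rho> \<in> slopes c" "real (game_value l c) \<le> \<rho> * real l"
      using game_value_le_slope[OF assms l] by (rule bexE)
    moreover have "\<rho> * real l \<le> \<delta> * real l"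
      using calculation(1) bdd unfolding \<delta>_def by (intro mult_right_mono cSup_upper) auto
    ultimately show ?thesis by linarith
  qed
  have "(\<lambda>l. real (game_value l c) / real l) \<longlonglongrightarrow> \<delta>"
  proof (rule order_tendstoI)
    fix y assume "y < \<delta>"
    have "slopes c \<noteq> {}" using game_value_le_slope[OF assms, of 1] by auto
    then obtain \<rho> where \<rho>: "\<rho> \<in> slopes c" "y < \<rho>"
      using \<open>y < \<delta>\<close> less_cSup_iff[OF _ bdd] unfolding \<delta>_def by blast
    obtain D L where DL: "\<And>l. L \<le> l \<Longrightarrow> \<rho> * (real l + 1) \<le> real (game_value l c) + D"
      by (rule slope_lower[OF \<rho>(1)]) blast
    \<comment> \<open>This is the lower bound \<open>\<rho> * (l + 1) - D\<close> divided by
      \<open>l\<close>.\<close>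
    have "(\<lambda>l. \<rho> + (\<rho> - D) / real l) \<longlonglongrightarrow> \<rho> + 0"
      by (intro tendsto_intros lim_const_over_n)
    then have "eventually (\<lambda>l. y < \<rho> + (\<rho> - D) / real l) sequentially"
      using \<rho> by (intro order_tendstoD(1)[of _ \<rho>]) auto
    then show "eventually (\<lambda>l. y < real (game_value l c) / real l) sequentially"
      using eventually_ge_at_top[of "max 1 L"]
    proof eventually_elim
      case (elim l)
      then have "\<rho> + (\<rho> - D) / real l = (\<rho> * (real l + 1) - D) / real l"
        by (simp add: field_simps)
      also have "\<dots> \<le> real (game_value l c) / real l"
        using DL[of l] elim by (intro divide_right_mono) auto
      finally have "\<rho> + (\<rho> - D) / real l \<le> real (game_value l c) / real l" .
      then show ?case using elim by linarith
    qed
  next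
    fix y assume "\<delta> < y"
    show "eventually (\<lambda>l. real (game_value l c) / real l < y) sequentially"
      using eventually_ge_at_top[of 1]
    proof eventually_elim
      case (elim l)
      then have "real (game_value l c) / real l \<le> \<delta>" using ub[of l] by (simp add: field_simps)
      then show ?case using \<open>\<delta> < y\<close> by simp
    qed
  qed
  then have "(\<lambda>l. \<delta> - real (game_value l c) / real l) \<longlonglongrightarrow> \<delta> - \<delta>"
    by (intro tendsto_intros)
  then show ?thesis using ub by (intro exI[of _ \<delta>]) auto
qed

section \<open>Connectivity and monochromatic paths\<close>

definition conn :: "('a, 'b) graph_scheme \<Rightarrow> 'a \<Rightarrow> 'a \<Rightarrow> bool" where
  "conn G = (adjacent G)\<^sup>*\<^sup>*"

lemma adjacent_sym: "adjacent G u v \<Longrightarrow> adjacent G v u"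
  by (simp add: adjacent_def insert_commute)

lemma conn_refl [simp]: "conn G u u"
  by (simp add: conn_def)

lemma conn_trans: "conn G u v \<Longrightarrow> conn G v w \<Longrightarrow> conn G u w"
  by (simp add: conn_def)

lemma conn_sym:
  assumes "conn G u v"
  shows "conn G v u"
  using assms unfolding conn_def
proof (induction rule: rtranclp_induct)
  case (step y z)
  then show ?case using adjacent_sym converse_rtranclp_into_rtranclp by metis
qed simp

lemma adjacent_conn: "adjacent G u v \<Longrightarrow> conn G u v"
  by (auto simp: conn_def)

lemma adjacent_verts:
  assumes "simple_graph G" "adjacent G u v"
  shows "u \<in> verts G" "v \<in> verts G" "u \<noteq> v"
proof -
  have "{u, v} \<subseteq> verts G" "card {u, v} = 2"
    using assms by (auto simp: simple_graph_def adjacent_def)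
  then show "u \<in> verts G" "v \<in> verts G" "u \<noteq> v" by auto
qed

lemma conn_verts:
  assumes "simple_graph G" "conn G u v" "u \<in> verts G"
  shows "v \<in> verts G"
  using assms(2,3) unfolding conn_def
  by (induction rule: rtranclp_induct) (auto dest: adjacent_verts[OF assms(1)])

lemma component_eq: "component G v = {u \<in> verts G. conn G v u}"
  by (simp add: component_def conn_def)

lemma component_cong: "conn G u v \<Longrightarrow> component G u = component G v"
proof -
  assume "conn G u v"
  then have "conn G u w \<longleftrightarrow> conn G v w" for w by (meson conn_trans conn_sym)
  then show ?thesis by (simp add: component_eq)
qed

lemma finite_component: "finite (verts G) \<Longrightarrow> finite (component G v)"
  by (simp add: component_eq)

lemma component_disjoint: "\<not> conn G u v \<Longrightarrow> component G u \<inter> component G v = {}"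
proof (rule ccontr)
  assume "\<not> conn G u v" "component G u \<inter> component G v \<noteq> {}"
  moreover from this obtain w where "conn G u w" "conn G v w" by (auto simp: component_eq)
  ultimately show False by (meson conn_trans conn_sym)
qed

lemma successively_conn: "successively (adjacent G) p \<Longrightarrow> u \<in> set p \<Longrightarrow> conn G (hd p) u"
proof (induction p)
  case (Cons a p)
  show ?case
  proof (cases "u = a \<or> p = []")
    case False
    then have "conn G (hd p) u" "adjacent G a (hd p)" using Cons by (auto simp: successively_Cons)
    then show ?thesis using adjacent_conn conn_trans by fastforce
  qed (use Cons in auto)
qed simp

text \<open>A simple path is extended edge by edge; if the next vertex already lies on it, the path
  is cut off there.\<close>

lemma conn_imp_path:
  assumes "conn G u w"
  shows "\<exists>p. distinct p \<and> successively (adjacent G) p \<and> p \<noteq> [] \<and> hd p = u \<and> last p = w"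
  using assms unfolding conn_def
proof (induction rule: rtranclp_induct)
  case base
  then show ?case by (intro exI[of _ "[u]"]) auto
next
  case (step y z)
  then obtain p where p: "distinct p" "successively (adjacent G) p" "p \<noteq> []" "hd p = u" "last p = y"
    by blast
  show ?case
  proof (cases "z \<in> set p")
    case True
    then obtain xs ys where "p = (xs @ [z]) @ ys" by (metis append.assoc append_Cons append_Nil split_list)
    then show ?thesis using p
      by (intro exI[of _ "xs @ [z]"]) (auto simp: successively_append_iff hd_append)
  next
    case False
    then show ?thesis using p step
      by (intro exI[of _ "p @ [z]"]) (auto simp: successively_append_iff)
  qed
qed

section \<open>Attaching a new vertex to a board\<close>

lemma verts_add_vertex [simp]: "verts (add_vertex B v N x) = insert v (verts B)"
  by (simp add: add_vertex_def)

lemma adjacent_add_vertex: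
  "adjacent (add_vertex B v N x) a b \<longleftrightarrow>
     adjacent B a b \<or> a = v \<and> b \<in> N \<or> b = v \<and> a \<in> N"
  by (auto simp: adjacent_def add_vertex_def doubleton_eq_iff)

lemma conn_add_vertex:
  assumes "conn B a b"
  shows "conn (add_vertex B v N x) a b"
  using assms unfolding conn_def
proof (induction rule: rtranclp_induct)
  case (step y z)
  then show ?case by (simp add: adjacent_add_vertex rtranclp.rtrancl_into_rtrancl)
qed simp

lemma conn_add_vertex_new:
  assumes "u \<in> N" "conn B u b"
  shows "conn (add_vertex B v N x) v b"
proof (rule conn_trans)
  show "conn (add_vertex B v N x) v u" using assms(1) by (intro adjacent_conn) (simp add: adjacent_add_vertex)
  show "conn (add_vertex B v N x) u b" using assms(2) by (rule conn_add_vertex)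
qed

lemma conn_add_vertex_newD:
  assumes "simple_graph B" "v \<notin> verts B" "conn (add_vertex B v N x) v b"
  shows "b = v \<or> (\<exists>u\<in>N. conn B u b)"
  using assms(3) unfolding conn_def
proof (induction rule: rtranclp_induct)
  case (step y z)
  then show ?case using adjacent_verts[OF assms(1), of v z] assms(2)
    by (auto simp: adjacent_add_vertex conn_def intro: rtranclp.rtrancl_into_rtrancl)
qed simp

lemma conn_add_vertex_oldD:
  assumes "simple_graph B" "v \<notin> verts B" "a \<in> verts B" "conn (add_vertex B v N x) a b"
    "\<And>u. u \<in> N \<Longrightarrow> \<not> conn B a u"
  shows "conn B a b"
  using assms(4) unfolding conn_def
proof (induction rule: rtranclp_induct)
  case (step y z)
  then have "conn B a y" by (simp add: conn_def)
  then have "y \<noteq> v" "y \<notin> N" using conn_verts assms by metis+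
  with step show ?case
    by (auto simp: adjacent_add_vertex intro: rtranclp.rtrancl_into_rtrancl)
qed simp

lemma component_add_vertex_colour:
  "component (add_vertex B v N x) = component (add_vertex B v N y)"
proof -
  have "adjacent (add_vertex B v N x) = adjacent (add_vertex B v N y)"
    by (intro ext) (simp only: adjacent_add_vertex)
  then show ?thesis by (intro ext) (simp add: component_def)
qed

lemma component_add_vertex_mono: "component B w \<subseteq> component (add_vertex B v N x) w"
  by (auto simp: component_eq intro: conn_add_vertex)

lemma simple_add_vertex:
  assumes "simple_graph B" "v \<notin> verts B" "N \<subseteq> verts B"
  shows "simple_graph (add_vertex B v N x)"
  unfolding simple_graph_def
proof
  fix e assume "e \<in> edges (add_vertex B v N x)"
  then consider "e \<in> edges B" | u where "e = {u, v}" "u \<in> N" by (auto simp: add_vertex_def)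
  then show "e \<subseteq> verts (add_vertex B v N x) \<and> card e = 2"
  proof cases
    case 1
    then show ?thesis using assms(1) by (auto simp: simple_graph_def)
  next
    case 2
    then have "u \<in> verts B" "u \<noteq> v" using assms(2,3) by auto
    then show ?thesis using 2 by simp
  qed
qed

text \<open>An old path between two distinct neighbours of \<open>v\<close> has at least two
  vertices and closes up through \<open>v\<close> to a cycle.\<close>

lemma forest_add_vertex_imp_not_conn:
  assumes "forest (add_vertex B v N x)" "simple_graph B" "v \<notin> verts B" "N \<subseteq> verts B"
    "u \<in> N" "w \<in> N" "u \<noteq> w"
  shows "\<not> conn B u w"
proof
  assume "conn B u w"
  then obtain p where p: "distinct p" "successively (adjacent B) p" "p \<noteq> []" "hd p = u" "last p = w"
    using conn_imp_path by metis
  have "set p \<subseteq> verts B"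
    using successively_conn[OF p(2)] conn_verts[OF assms(2)] assms p by blast
  then have v: "v \<notin> set p" using assms by blast
  have len: "2 \<le> length p" using p assms(7) by (cases p; cases "tl p") auto
  let ?B = "add_vertex B v N x"
  have "{(v # p) ! i, (v # p) ! (Suc i mod length (v # p))} \<in> edges ?B" if "i < length (v # p)" for i
  proof -
    consider "i = 0" | j where "i = Suc j" "Suc j < length p" | "i = length p" "i \<noteq> 0"
    proof (cases i)
      case (Suc j)
      then show thesis using that(2)[of j] that(3) \<open>i < length (v # p)\<close> by fastforce
    qed
    then have "adjacent ?B ((v # p) ! i) ((v # p) ! (Suc i mod length (v # p)))"
    proof cases
      case 1
      then show ?thesis using p assms len by (auto simp: adjacent_add_vertex hd_conv_nth)
    next
      case 2
      then show ?thesis using successively_nth[OF p(2), of j] by (auto simp: adjacent_add_vertex)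
    next
      case 3
      then show ?thesis using p assms by (auto simp: adjacent_add_vertex last_conv_nth nth_Cons')
    qed
    then show ?thesis by (simp add: adjacent_def)
  qed
  then have "is_cycle ?B (v # p)" using p v len by (simp add: is_cycle_def)
  then show False using assms(1) by (auto simp: forest_def)
qed

text \<open>A cycle avoiding \<open>v\<close> is already in \<open>B\<close>. A cycle through
  \<open>v\<close> visits two distinct neighbours of \<open>v\<close>, and its remaining part
  connects them inside \<open>B\<close>.\<close>

lemma forest_add_vertex:
  assumes "forest B" "v \<notin> verts B" "N \<subseteq> verts B"
    "\<And>u w. u \<in> N \<Longrightarrow> w \<in> N \<Longrightarrow> u \<noteq> w \<Longrightarrow> \<not> conn B u w"
  shows "forest (add_vertex B v N x)"
proof -
  let ?B = "add_vertex B v N x"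
  have sB: "simple_graph B" using assms by (simp add: forest_def)
  have s: "simple_graph ?B" by (rule simple_add_vertex[OF sB assms(2,3)])
  have "\<not> is_cycle ?B p" for p
  proof
    assume p: "is_cycle ?B p"
    let ?n = "length p"
    have n: "3 \<le> ?n" and d: "distinct p"
      and e: "\<And>i. i < ?n \<Longrightarrow> adjacent ?B (p ! i) (p ! (Suc i mod ?n))"
      using p by (auto simp: is_cycle_def adjacent_def)
    show False
    proof (cases "v \<in> set p")
      case False
      have "adjacent B (p ! i) (p ! (Suc i mod ?n))" if "i < ?n" for i
      proof -
        have "Suc i mod ?n < ?n" using n by (intro mod_less_divisor) auto
        then have "p ! i \<noteq> v" "p ! (Suc i mod ?n) \<noteq> v" using False that nth_mem by metis+
        then show ?thesis using e[OF that] by (simp add: adjacent_add_vertex)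
      qed
      then have "is_cycle B p" using p by (simp add: is_cycle_def adjacent_def)
      then show False using assms by (auto simp: forest_def)
    next
      case True
      then obtain j where j: "j < ?n" "p ! j = v" by (auto simp: in_set_conv_nth)
      \<comment> \<open>The cycle is rotated so that it starts at \<open>v\<close>; \<open>q\<close>
        is periodic, so index \<open>?n\<close> is \<open>v\<close> again.\<close>
      define q where "q i = p ! ((j + i) mod ?n)" for i
      have ad: "adjacent ?B (q i) (q (Suc i))" for i
      proof -
        have "(j + i) mod ?n < ?n" using n by (intro mod_less_divisor) auto
        then show ?thesis using e[of "(j + i) mod ?n"] by (simp add: q_def mod_Suc_eq)
      qed
      have inj: "q a \<noteq> q b" if "a < b" "b < ?n" for a b
      proof
        assume "q a = q b"
        then have "(j + a) mod ?n = (j + b) mod ?n"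
          unfolding q_def by (subst (asm) nth_eq_iff_index_eq[OF d]) (use n in \<open>auto intro!: mod_less_divisor\<close>)
        then have "?n dvd b - a"
          using mod_eq_dvd_iff_nat[of "j + a" "j + b" ?n] that by auto
        then show False using that by (auto dest: dvd_imp_le)
      qed
      have q0: "q 0 = v" using j by (simp add: q_def)
      have old: "adjacent B (q i) (q (Suc i))" if "1 \<le> i" "Suc i < ?n" for i
        using ad[of i] inj[of 0 i] inj[of 0 "Suc i"] q0 that by (auto simp: adjacent_add_vertex)
      have conn: "conn B (q 1) (q i)" if "1 \<le> i" "i < ?n" for i
        using that
      proof (induction i rule: dec_induct)
        case (step i)
        then show ?case using old[of i] adjacent_conn conn_trans by fastforce
      qed simp
      have "q ?n = v" using j by (simp add: q_def)
      moreover have "Suc (?n - 1) = ?n" using n by simp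
      ultimately have "adjacent ?B (q (?n - 1)) v" using ad[of "?n - 1"] by metis
      then have a1: "q (?n - 1) \<in> N"
        using adjacent_verts[OF s] adjacent_verts[OF sB] assms(2)
        by (auto simp: adjacent_add_vertex)
      have "adjacent ?B v (q 1)" using ad[of 0] q0 by simp
      then have a2: "q 1 \<in> N"
        using adjacent_verts[OF s] adjacent_verts[OF sB] assms(2)
        by (auto simp: adjacent_add_vertex)
      have "q 1 \<noteq> q (?n - 1)" using inj[of 1 "?n - 1"] n by auto
      moreover have "1 \<le> ?n - 1" "?n - 1 < ?n" using n by linarith+
      ultimately show False using assms(4)[OF a2 a1] conn by blast
    qed
  qed
  then show ?thesis using s by (simp add: forest_def)
qed

section \<open>Monochromatic paths\<close>

text \<open>The empty list is a path of every colour, in accordance with the entry 0 of the price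
  lists.\<close>

definition mono_path :: "'a board \<Rightarrow> nat \<Rightarrow> 'a list \<Rightarrow> bool" where
  "mono_path B x p \<longleftrightarrow> distinct p \<and> set p \<subseteq> verts B \<and> (\<forall>u\<in>set p. colour B u = x) \<and>
     successively (adjacent B) p"

lemma mono_path_imp_mono_copy:
  assumes "mono_path B x p" "n \<le> length p"
  shows "mono_copy (path_graph n) x B"
  unfolding mono_copy_def
proof (intro exI conjI)
  show "inj_on ((!) p) (verts (path_graph n))"
    using assms by (auto simp: path_graph_def mono_path_def inj_on_def nth_eq_iff_index_eq)
  show "(!) p ` verts (path_graph n) \<subseteq> {v \<in> verts B. colour B v = x}"
    using assms by (auto simp: path_graph_def mono_path_def subset_iff)
  have "adjacent B (p ! i) (p ! Suc i)" if "Suc i < n" for i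
    using successively_nth[of "adjacent B" p i] assms that by (simp add: mono_path_def)
  then show "\<forall>e\<in>edges (path_graph n). (!) p ` e \<in> edges B"
    by (auto simp: path_graph_def adjacent_def)
qed

lemma mono_copy_imp_mono_path:
  assumes "mono_copy (path_graph n) x B"
  shows "\<exists>p. mono_path B x p \<and> length p = n"
proof -
  obtain f where f: "inj_on f {..<n}" "f ` {..<n} \<subseteq> {v \<in> verts B. colour B v = x}"
    "\<forall>e\<in>edges (path_graph n). f ` e \<in> edges B"
    using assms unfolding mono_copy_def by (auto simp: path_graph_def)
  have e: "{f i, f (Suc i)} \<in> edges B" if "Suc i < n" for i
  proof -
    have "{i, Suc i} \<in> edges (path_graph n)" using that by (auto simp: path_graph_def)
    then have "f ` {i, Suc i} \<in> edges B" using f(3) by blast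
    then show ?thesis by simp
  qed
  have "mono_path B x (map f [0..<n])"
    unfolding mono_path_def successively_conv_nth
    using f(1,2) e by (auto simp: distinct_map atLeast0LessThan adjacent_def)
  then show ?thesis by (intro exI[of _ "map f [0..<n]"]) simp
qed

lemma mono_path_conn:
  assumes "mono_path B x p" "u \<in> set p" "w \<in> set p"
  shows "conn B u w"
proof -
  have "conn B (hd p) u" "conn B (hd p) w"
    using assms successively_conn unfolding mono_path_def by metis+
  then show ?thesis using conn_sym conn_trans by metis
qed

lemma mono_path_rev: "mono_path B x (rev p) \<longleftrightarrow> mono_path B x p"
proof -
  have *: "(\<lambda>a b. adjacent B b a) = adjacent B" by (intro ext) (auto intro: adjacent_sym)
  then show ?thesis unfolding mono_path_def successively_rev * by simp
qed

lemma mono_path_append: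
  "mono_path B x (p @ q) \<longleftrightarrow> mono_path B x p \<and> mono_path B x q \<and> set p \<inter> set q = {} \<and>
     (p \<noteq> [] \<and> q \<noteq> [] \<longrightarrow> adjacent B (last p) (hd q))"
proof -
  have "mono_path B x (p @ q) \<longleftrightarrow> distinct (p @ q) \<and> set (p @ q) \<subseteq> verts B \<and>
      (\<forall>u\<in>set (p @ q). colour B u = x) \<and> successively (adjacent B) (p @ q)"
    by (simp only: mono_path_def)
  also have "\<dots> \<longleftrightarrow> mono_path B x p \<and> mono_path B x q \<and> set p \<inter> set q = {} \<and>
     (p \<noteq> [] \<and> q \<noteq> [] \<longrightarrow> adjacent B (last p) (hd q))"
    unfolding mono_path_def successively_append_iff set_append ball_Un distinct_append Un_subset_iff
    by blast
  finally show ?thesis .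
qed

lemma mono_path_add_vertex:
  assumes "simple_graph B" "v \<notin> verts B" "N \<subseteq> verts B"
  shows "mono_path (add_vertex B v N y) x p \<and> v \<notin> set p \<longleftrightarrow> mono_path B x p"
proof (cases "v \<in> set p")
  case True
  then show ?thesis using assms by (auto simp: mono_path_def)
next
  case False
  have "successively (adjacent (add_vertex B v N y)) p \<longleftrightarrow> successively (adjacent B) p"
    using False by (intro successively_cong) (auto simp: adjacent_add_vertex)
  then show ?thesis using False
    by (auto simp: mono_path_def) (auto simp: add_vertex_def)
qed

section \<open>Painter's strategy\<close>

text \<open>The forest condition puts distinct neighbours of \<open>v\<close> into disjoint old
  components, and all of these merge with \<open>v\<close>.\<close>

lemma sum_card_components_less:
  assumes "forest (add_vertex B v N x)" "simple_graph B" "finite (verts B)" "v \<notin> verts B"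
    "N \<subseteq> verts B" "H \<subseteq> N"
  shows "1 + (\<Sum>u\<in>H. card (component B u)) \<le> card (component (add_vertex B v N x) v)"
proof -
  let ?U = "\<Union>u\<in>H. component B u"
  have finH: "finite H" using assms(3,5,6) by (meson finite_subset)
  have fin: "finite (component B u)" for u using assms(3) by (rule finite_component)
  have "card ?U = (\<Sum>u\<in>H. card (component B u))"
  proof (rule card_UN_disjoint[OF finH])
    show "\<forall>u\<in>H. \<forall>w\<in>H. u \<noteq> w \<longrightarrow> component B u \<inter> component B w = {}"
      using assms(6)
      by (intro ballI impI component_disjoint forest_add_vertex_imp_not_conn[OF assms(1,2,4,5)]) auto
  qed (simp add: fin)
  moreover have "v \<notin> ?U" using assms(4) by (auto simp: component_eq)
  ultimately have "1 + (\<Sum>u\<in>H. card (component B u)) = card (insert v ?U)"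
    using finH fin by (simp add: card_insert_disjoint)
  also have "\<dots> \<le> card (component (add_vertex B v N x) v)"
  proof (rule card_mono)
    show "finite (component (add_vertex B v N x) v)"
      using assms(3) by (intro finite_component) simp
    show "insert v ?U \<subseteq> component (add_vertex B v N x) v"
      using assms(6) by (auto simp: component_eq intro: conn_add_vertex_new)
  qed
  finally show ?thesis .
qed

text \<open>Painter's invariant: the prices of the fixed sequence of decisions are lower bounds for
  the components that contain the paths, and no path is as long as the list.\<close>

definition safe :: "nat list \<Rightarrow> nat \<Rightarrow> 'a board \<Rightarrow> bool" where
  "safe xs x B \<longleftrightarrow> (\<forall>p. mono_path B x p \<longrightarrow>
     length p < length xs \<and> (\<forall>w\<in>set p. xs ! length p \<le> card (component B w)))"

text \<open>Removing \<open>v\<close> from \<open>p\<close> leaves two old paths, and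
  \<open>H\<close> consists of their ends next to \<open>v\<close>. An empty piece contributes no
  neighbour, which is consistent with \<open>xs ! 0 = 0\<close>.\<close>

lemma safe_decompose:
  assumes "mono_path (add_vertex B v N x) x p" "v \<in> set p"
    "simple_graph B" "v \<notin> verts B" "N \<subseteq> verts B" "safe xs x B" "xs ! 0 = 0"
  obtains H a b where "H \<subseteq> N" "\<forall>u\<in>H. colour B u = x" "a + b + 1 = length p"
    "a < length xs" "b < length xs" "xs ! a + xs ! b \<le> (\<Sum>u\<in>H. card (component B u))"
proof -
  let ?B = "add_vertex B v N x"
  obtain p1 p2 where p: "p = p1 @ v # p2" using assms(2) split_list by metis
  have mp: "mono_path ?B x p1" "mono_path ?B x ([v] @ p2)" "set p1 \<inter> set ([v] @ p2) = {}"
    "p1 \<noteq> [] \<longrightarrow> adjacent ?B (last p1) v"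
    using assms(1) unfolding p by (auto simp: mono_path_append[of ?B x p1 "v # p2"])
  then have mp2: "mono_path ?B x p2" "v \<notin> set p2" "p2 \<noteq> [] \<longrightarrow> adjacent ?B v (hd p2)"
    by (auto simp only: mono_path_append) auto
  have vN: "u \<in> N" if "adjacent ?B u v \<or> adjacent ?B v u" for u
    using that adjacent_verts[OF assms(3)] adjacent_verts[OF simple_add_vertex[OF assms(3-5)]] assms(4)
    by (auto simp: adjacent_add_vertex)
  have old: "mono_path B x p1" "mono_path B x p2"
    using mp mp2 mono_path_add_vertex[OF assms(3-5)] by auto
  define H1 where "H1 = (if p1 = [] then {} else {last p1})"
  define H2 where "H2 = (if p2 = [] then {} else {hd p2})"
  have "H1 \<subseteq> set p1" "H2 \<subseteq> set p2" by (auto simp: H1_def H2_def)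
  then have "H1 \<inter> H2 = {}" using mp(3) by auto
  then have "(\<Sum>u\<in>H1 \<union> H2. card (component B u)) =
      (\<Sum>u\<in>H1. card (component B u)) + (\<Sum>u\<in>H2. card (component B u))"
    by (intro sum.union_disjoint) (auto simp: H1_def H2_def)
  moreover have "xs ! length p1 \<le> (\<Sum>u\<in>H1. card (component B u))"
    using assms(6,7) old(1) by (auto simp: H1_def safe_def)
  moreover have "xs ! length p2 \<le> (\<Sum>u\<in>H2. card (component B u))"
    using assms(6,7) old(2) by (auto simp: H2_def safe_def)
  ultimately have "xs ! length p1 + xs ! length p2 \<le> (\<Sum>u\<in>H1 \<union> H2. card (component B u))"
    by linarith
  moreover have "H1 \<union> H2 \<subseteq> N" using mp(4) mp2(3) vN by (auto simp: H1_def H2_def)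
  moreover have "\<forall>u\<in>H1 \<union> H2. colour B u = x"
    using old by (auto simp: H1_def H2_def mono_path_def)
  moreover have "length p1 + length p2 + 1 = length p" by (simp add: p)
  moreover have "length p1 < length xs" "length p2 < length xs"
    using assms(6) old by (auto simp: safe_def)
  ultimately show ?thesis using that by blast
qed

lemma longest_mono_path:
  assumes "finite (verts B)"
  obtains p where "mono_path (add_vertex B v N x) x p" "v \<in> set p"
    "\<And>q. mono_path (add_vertex B v N x) x q \<Longrightarrow> v \<in> set q \<Longrightarrow> length q \<le> length p"
proof -
  let ?B = "add_vertex B v N x"
  let ?P = "\<lambda>q. mono_path ?B x q \<and> v \<in> set q"
  have v: "?P [v]" by (simp add: mono_path_def) (simp add: add_vertex_def)
  have bound: "length q \<le> card (verts ?B)" if "?P q" for q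
  proof -
    have "length q = card (set q)" using that by (simp add: mono_path_def distinct_card)
    also have "\<dots> \<le> card (verts ?B)"
      using that assms by (intro card_mono) (auto simp: mono_path_def)
    finally show ?thesis .
  qed
  have "\<exists>p. ?P p \<and> (\<forall>q. ?P q \<longrightarrow> length q \<le> length p)"
    using v bound by (intro ex_has_greatest_nat[of ?P "[v]" length "Suc (card (verts ?B))"]) (auto simp: less_Suc_eq_le)
  then obtain p where p: "?P p" "\<forall>q. ?P q \<longrightarrow> length q \<le> length p" by metis
  show ?thesis
  proof (rule that[of p])
    show "mono_path ?B x p" "v \<in> set p" using p(1) by auto
    show "length q \<le> length p" if "mono_path ?B x q" "v \<in> set q" for q
      using p(2) that by auto
  qed
qed

lemma safe_old_path:
  assumes "safe xs y B" "finite (verts B)" "mono_path B y p"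
  shows "length p < length xs \<and>
    (\<forall>w\<in>set p. xs ! length p \<le> card (component (add_vertex B v N x) w))"
proof -
  have "card (component B w) \<le> card (component (add_vertex B v N x) w)" for w
    using assms(2) by (intro card_mono component_add_vertex_mono finite_component) simp
  then show ?thesis using assms(1,3) unfolding safe_def by (meson order_trans)
qed

lemma safe_other_colour:
  assumes "safe xs y B" "finite (verts B)" "x \<noteq> y" "simple_graph B" "v \<notin> verts B" "N \<subseteq> verts B"
  shows "safe xs y (add_vertex B v N x)"
  unfolding safe_def
proof (intro allI impI)
  fix p assume p: "mono_path (add_vertex B v N x) y p"
  have "colour (add_vertex B v N x) v = x" by (simp add: add_vertex_def)
  then have "v \<notin> set p" using p assms(3) by (auto simp: mono_path_def)
  then have "mono_path B y p" using p mono_path_add_vertex[OF assms(4-6)] by blast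
  then show "length p < length xs \<and>
      (\<forall>w\<in>set p. xs ! length p \<le> card (component (add_vertex B v N x) w))"
    by (rule safe_old_path[OF assms(1,2)])
qed

text \<open>One price check at the maximal length \<open>m\<close> suffices: shorter paths through
  \<open>v\<close> have smaller prices by sortedness, and all of them lie in the component of
  \<open>v\<close>.\<close>

lemma safe_same_colour:
  assumes "safe xs x B" "finite (verts B)" "simple_graph B" "v \<notin> verts B" "N \<subseteq> verts B"
    and "sorted xs" "m < length xs" "xs ! m \<le> card (component (add_vertex B v N x) v)"
    and "\<And>q. mono_path (add_vertex B v N x) x q \<Longrightarrow> v \<in> set q \<Longrightarrow> length q \<le> m"
  shows "safe xs x (add_vertex B v N x)"
  unfolding safe_def
proof (intro allI impI)
  fix p assume p: "mono_path (add_vertex B v N x) x p"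
  show "length p < length xs \<and>
      (\<forall>w\<in>set p. xs ! length p \<le> card (component (add_vertex B v N x) w))"
  proof (cases "v \<in> set p")
    case False
    then have "mono_path B x p" using p mono_path_add_vertex[OF assms(3-5)] by blast
    then show ?thesis by (rule safe_old_path[OF assms(1,2)])
  next
    case True
    then have len: "length p \<le> m" using p assms(9) by blast
    then have "xs ! length p \<le> xs ! m" using assms(6,7) by (intro sorted_nth_mono) auto
    moreover have "component (add_vertex B v N x) w = component (add_vertex B v N x) v"
      if "w \<in> set p" for w
      using component_cong[OF mono_path_conn[OF p that True]] .
    ultimately show ?thesis using len assms(7,8) by auto
  qed
qed

text \<open>The longest red and the longest blue path that \<open>v\<close> could close cut into
  four old pieces, whose prices bound the new component from below. If both paths reached the ends
  of the lists, the component would have at least \<open>cost rs bs\<close> vertices, which is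
  illegal. Otherwise \<open>reach_priority\<close> names a colour whose price the component already
  covers.\<close>

lemma painter_step:
  assumes "reach rs bs" "finite (verts B)" "simple_graph B" "safe rs 1 B" "safe bs 2 B"
    and "legal_move k B v N" "k < cost rs bs"
  shows "\<exists>x\<in>{1, 2}. safe rs 1 (add_vertex B v N x) \<and> safe bs 2 (add_vertex B v N x)"
proof -
  have v: "v \<notin> verts B" "N \<subseteq> verts B" and f: "forest (add_vertex B v N 1)"
    and c: "card (component (add_vertex B v N 1) v) \<le> k"
    using assms(6) by (auto simp: legal_move_def Let_def)
  note sorted = reach_sorted[OF assms(1)] and zero = reach_nth_0[OF assms(1)]
  define s where "s = card (component (add_vertex B v N 1) v)"
  have s: "card (component (add_vertex B v N x) v) = s" for x
    unfolding s_def by (simp add: component_add_vertex_colour[of B v N x 1])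
  obtain p where p: "mono_path (add_vertex B v N 1) 1 p" "v \<in> set p"
    "\<And>q. mono_path (add_vertex B v N 1) 1 q \<Longrightarrow> v \<in> set q \<Longrightarrow> length q \<le> length p"
    using longest_mono_path[OF assms(2), of v N 1] by metis
  obtain q where q: "mono_path (add_vertex B v N 2) 2 q" "v \<in> set q"
    "\<And>r. mono_path (add_vertex B v N 2) 2 r \<Longrightarrow> v \<in> set r \<Longrightarrow> length r \<le> length q"
    using longest_mono_path[OF assms(2), of v N 2] by metis
  obtain H a b where H: "H \<subseteq> N" "\<forall>u\<in>H. colour B u = 1" "a + b + 1 = length p"
    "a < length rs" "b < length rs" "rs ! a + rs ! b \<le> (\<Sum>u\<in>H. card (component B u))"
    using safe_decompose[OF p(1,2) assms(3) v assms(4)] zero by metis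
  obtain J i j where J: "J \<subseteq> N" "\<forall>u\<in>J. colour B u = 2" "i + j + 1 = length q"
    "i < length bs" "j < length bs" "bs ! i + bs ! j \<le> (\<Sum>u\<in>J. card (component B u))"
    using safe_decompose[OF q(1,2) assms(3) v assms(5)] zero by metis
  have fin: "finite H" "finite J" using H J v assms(2) by (meson finite_subset)+
  \<comment> \<open>The two sets have different colours, so their components may be added
    up.\<close>
  have "H \<inter> J = {}" using H(2) J(2) by force
  then have "(\<Sum>u\<in>H. card (component B u)) + (\<Sum>u\<in>J. card (component B u)) =
      (\<Sum>u\<in>H \<union> J. card (component B u))"
    using fin by (simp add: sum.union_disjoint)
  moreover have "1 + (\<Sum>u\<in>H \<union> J. card (component B u)) \<le> s"
    unfolding s_def using H(1) J(1)
    by (intro sum_card_components_less f assms(2,3) v) auto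
  ultimately have size: "1 + (rs ! a + rs ! b) + (bs ! i + bs ! j) \<le> s"
    using H(6) J(6) by linarith
  \<comment> \<open>The lengths are cut off at the next path to be priced; if the cut-off index is
    inside the list, it is the true length.\<close>
  define m where "m = min (length p) (length rs)"
  define n where "n = min (length q) (length bs)"
  have "msum rs m \<le> rs ! a + rs ! b"
    unfolding m_def using msum_min_length_le[OF sorted(1) H(4,5)] H(3) by simp
  moreover have "msum bs n \<le> bs ! i + bs ! j"
    unfolding n_def using msum_min_length_le[OF sorted(2) J(4,5)] J(3) by simp
  ultimately have le: "1 + msum rs m + msum bs n \<le> s" using size by linarith
  have mn: "1 \<le> m" "m \<le> length rs" "1 \<le> n" "n \<le> length bs"
    using H(3) J(3) reach_length[OF assms(1)] by (auto simp: m_def n_def)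
  have "m < length rs \<or> n < length bs"
  proof (rule ccontr)
    assume "\<not> ?thesis"
    then have "cost rs bs \<le> s" using le mn by (simp add: cost_def)
    then show False using c assms(7) by (simp add: s_def)
  qed
  then consider "m < length rs" "rs ! m \<le> s" | "n < length bs" "bs ! n \<le> s"
    using reach_priority[OF assms(1) mn] le by linarith
  then show ?thesis
  proof cases
    case 1
    then have "length p = m" by (simp add: m_def)
    then have "safe rs 1 (add_vertex B v N 1)"
      using 1 s p(3) by (intro safe_same_colour[OF assms(4,2,3) v sorted(1)]) auto
    then show ?thesis using safe_other_colour[OF assms(5,2) _ assms(3) v, of 1] by auto
  next
    case 2
    then have "length q = n" by (simp add: n_def)
    then have "safe bs 2 (add_vertex B v N 2)"
      using 2 s q(3) by (intro safe_same_colour[OF assms(5,2,3) v sorted(2)]) auto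
    then show ?thesis using safe_other_colour[OF assms(4,2) _ assms(3) v, of 2] by auto
  qed
qed

text \<open>\<open>safe\<close> excludes a loss since all paths stay shorter than
  \<open>length rs\<close> and \<open>length bs\<close>, and \<open>painter_step\<close> maintains
  it against every legal move.\<close>

lemma painter_survives:
  assumes "reach rs bs" "length rs \<le> l" "length bs \<le> c" "k < cost rs bs"
    and "finite (verts B)" "simple_graph B" "safe rs 1 B" "safe bs 2 B"
  shows "\<not> builder_forces k (path_graph l) (path_graph c) n B"
proof -
  have not_lost: "\<not> painter_lost (path_graph l) (path_graph c) B"
    if "safe rs 1 B" "safe bs 2 B" for B :: "'a board"
    using that assms(2,3) unfolding painter_lost_def safe_def
    by (auto dest!: mono_copy_imp_mono_path)
  show ?thesis
    using assms(5-)
  proof (induction n arbitrary: B)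
    case 0
    then show ?case using not_lost by simp
  next
    case (Suc n)
    have "\<exists>x\<in>{1, 2}. \<not> builder_forces k (path_graph l) (path_graph c) n (add_vertex B v N x)"
      if legal: "legal_move k B v N" for v N
    proof -
      obtain x where x: "x \<in> {1, 2}" "safe rs 1 (add_vertex B v N x)" "safe bs 2 (add_vertex B v N x)"
        using painter_step[OF assms(1) Suc.prems legal assms(4)] by blast
      have "simple_graph (add_vertex B v N x)"
        using legal by (intro simple_add_vertex Suc.prems) (auto simp: legal_move_def)
      then have "\<not> builder_forces k (path_graph l) (path_graph c) n (add_vertex B v N x)"
        using x Suc.prems(1) by (intro Suc.IH) auto
      then show ?thesis using x by blast
    qed
    then show ?case using not_lost Suc.prems by fastforce
  qed
qed

lemma game_value_le_of_builder_wins: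
  assumes "builder_wins k (path_graph l) (path_graph c)" "1 \<le> l" "1 \<le> c"
  shows "game_value l c \<le> k"
proof (rule ccontr)
  assume less: "\<not> game_value l c \<le> k"
  obtain rs bs where r: "reach rs bs" "length rs = l" "length bs = c" "game_value l c = cost rs bs"
    using game_value_attained[OF assms(2,3)] by metis
  have "safe xs x (empty_board :: nat board)" if "1 \<le> length xs" for xs x
    using that by (auto simp: safe_def mono_path_def empty_board_def)
  then have "\<not> builder_forces k (path_graph l) (path_graph c) n (empty_board :: nat board)" for n
    using r less reach_length[OF r(1)]
    by (intro painter_survives[OF r(1)]) (auto simp: empty_board_def simple_graph_def)
  then show False using assms(1) by (auto simp: builder_wins_def)
qed

section \<open>Builder's strategy\<close>

type_synonym spec = "nat \<times> nat \<times> nat"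

text \<open>A triple \<open>(x, a, e)\<close> promises a path on \<open>a\<close> vertices of colour \<open>x\<close> that ends in the given vertex,
  in a component with at most \<open>e\<close> vertices.\<close>

definition offers :: "'a board \<Rightarrow> 'a \<Rightarrow> spec \<Rightarrow> bool" where
  "offers B u s \<longleftrightarrow> (case s of (x, a, e) \<Rightarrow>
     (\<exists>p. mono_path B x p \<and> p \<noteq> [] \<and> hd p = u \<and> length p = a) \<and> card (component B u) \<le> e)"

definition separated :: "'a board \<Rightarrow> 'a set \<Rightarrow> bool" where
  "separated B X \<longleftrightarrow> (\<forall>u\<in>X. \<forall>w\<in>X. u \<noteq> w \<longrightarrow> \<not> conn B u w)"

text \<open>Every resource, counted with multiplicity, has its own representative in a component of
  its own, so that resources can be spent independently.\<close>

definition stocked :: "'a board \<Rightarrow> 'a set \<Rightarrow> ('a \<Rightarrow> spec) \<Rightarrow> spec multiset \<Rightarrow> bool" where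
  "stocked B X s M \<longleftrightarrow> finite X \<and> (\<forall>u\<in>X. offers B u (s u)) \<and> separated B X \<and>
     image_mset s (mset_set X) = M"

definition stock :: "nat \<Rightarrow> 'a board \<Rightarrow> spec multiset \<Rightarrow> bool" where
  "stock k B M \<longleftrightarrow> finite (verts B) \<and> forest B \<and> (\<forall>w\<in>verts B. card (component B w) \<le> k) \<and>
     (\<exists>X s. stocked B X s M)"

lemma offers_verts: "offers B u s \<Longrightarrow> u \<in> verts B"
  unfolding offers_def mono_path_def by (auto simp: split_def)

lemma offersE:
  assumes "offers B u (x, a, e)"
  obtains p where "mono_path B x p" "p \<noteq> []" "hd p = u" "length p = a" "card (component B u) \<le> e"
  using assms unfolding offers_def by auto

text \<open>A submultiset of \<open>mset_set X\<close> has multiplicities at most 1 and hence comes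
  from a subset \<open>Y\<close>; this assigns representatives to each half.\<close>

lemma stocked_split:
  assumes "stocked B X s (M + R)"
  obtains Y where "Y \<subseteq> X" "stocked B Y s M" "stocked B (X - Y) s R"
proof -
  have fin: "finite X" and im: "image_mset s (mset_set X) = M + R"
    and st: "\<forall>u\<in>X. offers B u (s u)" "separated B X"
    using assms by (auto simp: stocked_def)
  obtain A C where AC: "mset_set X = A + C" "M = image_mset s A" "R = image_mset s C"
    using image_mset_eq_plusD[OF im] by auto
  define Y where "Y = set_mset A"
  have le: "count A u \<le> 1" for u
  proof -
    have "count A u \<le> count (mset_set X) u" by (simp add: AC(1))
    also have "\<dots> \<le> 1" by (simp add: count_mset_set')
    finally show ?thesis .
  qed
  have YX: "Y \<subseteq> X"
  proof -
    have "set_mset (mset_set X) = X" using fin by simp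
    then show ?thesis unfolding AC(1) by (auto simp: Y_def)
  qed
  have A: "A = mset_set Y"
  proof (rule multiset_eqI)
    fix u
    show "count A u = count (mset_set Y) u"
      using le[of u] count_greater_zero_iff[of A u] by (cases "u \<in># A") (auto simp: Y_def count_mset_set' simp del: count_greater_zero_iff)
  qed
  have C: "C = mset_set (X - Y)"
    using mset_set_Diff[OF fin YX] AC(1) A by simp
  have "stocked B Y s M" "stocked B (X - Y) s R"
    using fin st YX AC A C finite_subset[OF YX]
    by (auto simp: stocked_def separated_def)
  then show ?thesis using that YX by blast
qed

text \<open>Paths without vertices need no representative on the board.\<close>

definition part :: "nat \<Rightarrow> nat \<Rightarrow> nat \<Rightarrow> spec multiset" where
  "part x a e = (if a = 0 then {#} else {#(x, a, e)#})"

lemma stocked_part: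
  assumes "stocked B X s (part x a e + R)"
  obtains Y q where "Y \<subseteq> X" "stocked B (X - Y) s R" "mono_path B x q" "length q = a"
    "q \<noteq> [] \<Longrightarrow> hd q \<in> Y"
proof (cases "a = 0")
  case True
  show ?thesis
    by (rule that[of "{}" "[]"]) (use True assms in \<open>auto simp: part_def mono_path_def\<close>)
next
  case False
  obtain Y where Y: "Y \<subseteq> X" "stocked B Y s {#(x, a, e)#}" "stocked B (X - Y) s R"
    using stocked_split[OF assms] False by (metis part_def)
  then have im: "image_mset s (mset_set Y) = {#(x, a, e)#}" by (simp add: stocked_def)
  then have "size (image_mset s (mset_set Y)) = 1" by simp
  then have "card Y = 1" by simp
  then obtain u where u: "Y = {u}" by (auto simp: card_1_singleton_iff)
  then have "offers B u (x, a, e)" using im Y(2) by (simp add: stocked_def)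
  then obtain p where p: "mono_path B x p" "p \<noteq> []" "hd p = u" "length p = a"
    by (rule offersE)
  show ?thesis by (rule that[of Y p]) (use p Y u in auto)
qed

text \<open>The new path is the reversal of the first path, then \<open>v\<close>, then the second
  path; they are disjoint because their ends represent different components. Joining
  \<open>v\<close> to the remaining representatives as well does no harm and lets one move threaten
  both colours.\<close>

lemma mono_path_join:
  assumes "simple_graph B" "v \<notin> verts B" "X \<subseteq> verts B"
    "stocked B X s (part x a e + (part x b f + R))"
  obtains p where "mono_path (add_vertex B v X x) x p" "v \<in> set p" "length p = a + b + 1"
proof -
  let ?B = "add_vertex B v X x"
  obtain Y q where Y: "Y \<subseteq> X" "stocked B (X - Y) s (part x b f + R)" "mono_path B x q"
    "length q = a" "q \<noteq> [] \<Longrightarrow> hd q \<in> Y"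
    using stocked_part[OF assms(4)] by metis
  obtain Z r where Z: "Z \<subseteq> X - Y" "mono_path B x r" "length r = b" "r \<noteq> [] \<Longrightarrow> hd r \<in> Z"
    using stocked_part[OF Y(2)] by metis
  have disj: "set q \<inter> set r = {}"
  proof (rule ccontr)
    assume "set q \<inter> set r \<noteq> {}"
    then obtain u where u: "u \<in> set q" "u \<in> set r" by auto
    then have ne: "q \<noteq> []" "r \<noteq> []" by auto
    have "conn B (hd q) u" "conn B u (hd r)"
      using mono_path_conn[OF Y(3)] mono_path_conn[OF Z(2)] u ne by auto
    then have "conn B (hd q) (hd r)" by (rule conn_trans)
    moreover have "hd q \<in> Y" "hd r \<in> Z" using ne Y Z by auto
    moreover from this have "hd q \<noteq> hd r" "hd q \<in> X" "hd r \<in> X" using Y(1) Z(1) by auto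
    ultimately show False using assms(4) by (auto simp: stocked_def separated_def)
  qed
  have up: "mono_path ?B x q" "v \<notin> set q" "mono_path ?B x r" "v \<notin> set r"
    using mono_path_add_vertex[OF assms(1-3)] Y(3) Z(2) by blast+
  have "mono_path ?B x [v]" by (simp add: mono_path_def) (simp add: add_vertex_def)
  moreover have "adjacent ?B v (hd r)" if "r \<noteq> []"
    using Z(1,4) that by (auto simp: adjacent_add_vertex)
  ultimately have vr: "mono_path ?B x ([v] @ r)"
    using up by (subst mono_path_append) auto
  have "adjacent ?B (last (rev q)) v" if "q \<noteq> []"
    using Y(1,5) that by (auto simp: adjacent_add_vertex last_rev)
  then have "mono_path ?B x (rev q @ ([v] @ r))"
    using vr up disj by (subst mono_path_append) (auto simp: mono_path_rev)
  then show ?thesis by (rule that) (use Y Z in auto)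
qed

lemma card_component_join_le:
  assumes "simple_graph B" "finite (verts B)" "v \<notin> verts B" "Y \<subseteq> verts B" "stocked B Y s U"
  shows "card (component (add_vertex B v Y x) v) \<le> 1 + (\<Sum>(y, a, e)\<in>#U. e)"
proof -
  let ?U = "\<Union>u\<in>Y. component B u"
  have finY: "finite Y" using assms(5) by (simp add: stocked_def)
  have le: "card (component B u) \<le> snd (snd (s u))" if "u \<in> Y" for u
    using assms(5) that by (force simp: stocked_def offers_def split_def)
  have "component (add_vertex B v Y x) v \<subseteq> insert v ?U"
    using conn_add_vertex_newD[OF assms(1,3)] by (auto simp: component_eq)
  moreover have "finite ?U" using finY finite_component[OF assms(2)] by auto
  ultimately have "card (component (add_vertex B v Y x) v) \<le> card (insert v ?U)"
    by (intro card_mono) auto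
  also have "\<dots> \<le> Suc (card ?U)" by (rule card_insert_le_m1) auto
  also have "card ?U \<le> (\<Sum>u\<in>Y. card (component B u))" using finY by (rule card_UN_le)
  also have "\<dots> \<le> (\<Sum>u\<in>Y. snd (snd (s u)))" using le by (rule sum_mono)
  also have "\<dots> = (\<Sum>t\<in>#image_mset s (mset_set Y). snd (snd t))"
    by (simp add: sum_unfold_sum_mset image_mset.compositionality comp_def)
  also have "\<dots> = (\<Sum>(y, a, e)\<in>#U. e)" using assms(5) by (simp add: stocked_def split_def)
  finally show ?thesis by simp
qed

text \<open>The move joins a fresh vertex to all representatives of \<open>U\<close>, which is read
  once as two red parts and once as two blue parts. Whichever colour is chosen, \<open>U\<close> is
  traded for one new path, and the components representing \<open>M\<close> are not touched.\<close>

lemma stock_move: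
  fixes B :: "nat board"
  assumes "stock k B (M + U)" "1 + (\<Sum>(y, a, e)\<in>#U. e) \<le> K" "K \<le> k"
    and U1: "U = part 1 a e1 + (part 1 b e2 + R1)"
    and U2: "U = part 2 i e3 + (part 2 j e4 + R2)"
  shows "\<exists>v N. legal_move k B v N \<and>
    stock k (add_vertex B v N 1) (M + {#(1, a + b + 1, K)#}) \<and>
    stock k (add_vertex B v N 2) (M + {#(2, i + j + 1, K)#})"
proof -
  have fin: "finite (verts B)" and fo: "forest B" and small: "\<forall>w\<in>verts B. card (component B w) \<le> k"
    using assms(1) by (auto simp: stock_def)
  have sB: "simple_graph B" using fo by (simp add: forest_def)
  obtain X s where X: "stocked B X s (U + M)"
    using assms(1) by (auto simp: stock_def add.commute)
  obtain Y where Y: "Y \<subseteq> X" "stocked B Y s U" "stocked B (X - Y) s M"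
    using stocked_split[OF X] by metis
  have XV: "X \<subseteq> verts B" using X offers_verts by (fastforce simp: stocked_def)
  then have YV: "Y \<subseteq> verts B" using Y by blast
  obtain v where v: "v \<notin> verts B" using fin ex_new_if_finite infinite_UNIV_nat by blast
  have sepX: "\<not> conn B u w" if "u \<in> X" "w \<in> X" "u \<noteq> w" for u w
    using X that by (auto simp: stocked_def separated_def)
  have forest: "forest (add_vertex B v Y x)" for x
    using Y(1) sepX by (intro forest_add_vertex[OF fo v YV]) auto
  have big: "card (component (add_vertex B v Y x) v) \<le> K" for x
    using card_component_join_le[OF sB fin v YV Y(2), of x] assms(2) by linarith
  have conn_v: "\<exists>u\<in>Y. conn B w u" if "w \<in> verts B" "conn (add_vertex B v Y x) v w" for w x
    using conn_add_vertex_newD[OF sB v that(2)] that(1) v conn_sym by metis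
  have comp_old: "component (add_vertex B v Y x) w \<subseteq> component B w"
    if w: "w \<in> verts B" "\<And>u. u \<in> Y \<Longrightarrow> \<not> conn B w u" for w x
  proof
    fix z assume "z \<in> component (add_vertex B v Y x) w"
    then have "conn B w z"
      using conn_add_vertex_oldD[OF sB v w(1) _ w(2)] by (auto simp: component_eq)
    then show "z \<in> component B w" using conn_verts[OF sB _ w(1)] by (simp add: component_eq)
  qed
  have card_old: "card (component (add_vertex B v Y x) w) \<le> card (component B w)"
    if "w \<in> verts B" "\<And>u. u \<in> Y \<Longrightarrow> \<not> conn B w u" for w x
    using comp_old[OF that] fin by (intro card_mono finite_component) auto
  have sizes: "card (component (add_vertex B v Y x) w) \<le> k" if "w \<in> verts (add_vertex B v Y x)" for w x
  proof (cases "conn (add_vertex B v Y x) v w")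
    case True
    then show ?thesis using component_cong[OF True] big[of x] assms(3) by simp
  next
    case False
    then have w: "w \<in> verts B" using that by auto
    have "\<not> conn B w u" if "u \<in> Y" for u
      using False that conn_add_vertex_new conn_sym by metis
    then have "card (component (add_vertex B v Y x) w) \<le> card (component B w)" using card_old w by blast
    then show ?thesis using small w by force
  qed
  have legal: "legal_move k B v Y"
    using v YV forest sizes by (simp add: legal_move_def Let_def)
  have stock: "stock k (add_vertex B v Y x) (M + {#(x, length p, K)#})"
    if p: "mono_path (add_vertex B v Y x) x p" "v \<in> set p" for x p
  proof -
    let ?B = "add_vertex B v Y x"
    \<comment> \<open>The new representative must be an end of the path, as \<open>offers\<close>
      requires, so in general it is not \<open>v\<close>.\<close>
    define h where "h = hd p"
    have ne: "p \<noteq> []" using p by auto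
    have vh: "conn ?B v h" using mono_path_conn[OF p(1) p(2)] ne by (simp add: h_def)
    have new: "offers ?B h (x, length p, K)"
      unfolding offers_def using p(1) ne big[of x] component_cong[OF vh] by (auto simp: h_def)
    have nY: "\<not> conn B u w" if "u \<in> X - Y" "w \<in> Y" for u w
      using that Y(1) by (intro sepX) auto
    have far: "\<not> conn ?B v u" if "u \<in> X - Y" for u
      using conn_v[of u x] nY[OF that] XV that by blast
    then have hX: "h \<notin> X - Y" using vh by blast
    have old: "offers ?B u (s u)" if u: "u \<in> X - Y" for u
    proof -
      obtain y m e where s: "s u = (y, m, e)" by (cases "s u")
      have "offers B u (y, m, e)" using Y(3) u s by (metis stocked_def)
      then obtain q where q: "mono_path B y q" "q \<noteq> []" "hd q = u" "length q = m"
        "card (component B u) \<le> e" by (rule offersE)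
      have "card (component ?B u) \<le> card (component B u)"
        using u XV nY[OF u] by (intro card_old) auto
      moreover have "mono_path ?B y q" using q(1) mono_path_add_vertex[OF sB v YV] by blast
      ultimately show ?thesis unfolding s offers_def using q by auto
    qed
    define s' where "s' = s(h := (x, length p, K))"
    have "stocked ?B (insert h (X - Y)) s' (M + {#(x, length p, K)#})"
      unfolding stocked_def
    proof (intro conjI)
      have finXY: "finite (X - Y)" using Y(3) by (simp add: stocked_def)
      then show "finite (insert h (X - Y))" by simp
      show "\<forall>u\<in>insert h (X - Y). offers ?B u (s' u)"
        using new old hX by (auto simp: s'_def)
      have "\<not> conn ?B u w" if "u \<in> X - Y" "w \<in> X - Y" "u \<noteq> w" for u w
      proof
        assume "conn ?B u w"
        then have "conn B u w" using conn_add_vertex_oldD[OF sB v _ _ nY[OF that(1)]] that XV by blast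
        then show False using sepX that by blast
      qed
      moreover have "\<not> conn ?B h u" "\<not> conn ?B u h" if "u \<in> X - Y" for u
        using far[OF that] vh conn_trans conn_sym by metis+
      ultimately show "separated ?B (insert h (X - Y))" by (auto simp: separated_def)
      have "image_mset s' (mset_set (X - Y)) = image_mset s (mset_set (X - Y))"
        using hX finXY by (intro image_mset_cong) (auto simp: s'_def)
      then show "image_mset s' (mset_set (insert h (X - Y))) = M + {#(x, length p, K)#}"
        using finXY hX Y(3) by (simp add: stocked_def s'_def)
    qed
    then show ?thesis unfolding stock_def using fin forest sizes by auto
  qed
  obtain p where p: "mono_path (add_vertex B v Y 1) 1 p" "v \<in> set p" "length p = a + b + 1"
    using mono_path_join[OF sB v YV Y(2)[unfolded U1]] by metis
  obtain q where q: "mono_path (add_vertex B v Y 2) 2 q" "v \<in> set q" "length q = i + j + 1"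
    using mono_path_join[OF sB v YV Y(2)[unfolded U2]] by metis
  show ?thesis using legal stock[OF p(1,2)] stock[OF q(1,2)] p(3) q(3) by auto
qed

lemma stock_mono:
  assumes "stock k B M'" "M \<subseteq># M'"
  shows "stock k B M"
proof -
  obtain X s where X: "stocked B X s (M + (M' - M))" using assms by (auto simp: stock_def)
  obtain Y where "stocked B Y s M" using stocked_split[OF X] by metis
  then show ?thesis using assms(1) by (auto simp: stock_def)
qed

lemma builder_forces_mono:
  "builder_forces k F1 F2 n B \<Longrightarrow> n \<le> m \<Longrightarrow> builder_forces k F1 F2 m B"
proof (induction n arbitrary: B m)
  case 0
  then show ?case by (cases m) auto
next
  case (Suc n)
  then obtain m' where m: "m = Suc m'" "n \<le> m'" by (cases m) auto
  show ?case using Suc.prems(1) Suc.IH[OF _ m(2)] unfolding m(1) builder_forces.simps(2) by metis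
qed

section \<open>Winning as a property of the stock alone\<close>

definition wins_from :: "nat \<Rightarrow> nat \<Rightarrow> nat \<Rightarrow> spec multiset \<Rightarrow> bool" where
  "wins_from k l c M \<longleftrightarrow> (\<forall>B :: nat board. stock k B M \<longrightarrow>
     (\<exists>n. builder_forces k (path_graph l) (path_graph c) n B))"

lemma wins_from_mono: "wins_from k l c M \<Longrightarrow> M \<subseteq># M' \<Longrightarrow> wins_from k l c M'"
  using stock_mono unfolding wins_from_def by metis

lemma wins_from_terminal:
  assumes "(1, l, e) \<in># M \<or> (2, c, e) \<in># M"
  shows "wins_from k l c M"
  unfolding wins_from_def
proof (intro allI impI)
  fix B :: "nat board" assume B: "stock k B M"
  have copy: "mono_copy (path_graph a) x B" if mem: "(x, a, e) \<in># M" for x a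
  proof -
    obtain X s where X: "stocked B X s M" using B by (auto simp: stock_def)
    then have "(x, a, e) \<in># image_mset s (mset_set X)" using mem by (simp add: stocked_def)
    then obtain u where "u \<in> X" "s u = (x, a, e)" using X by (auto simp: stocked_def)
    then have "offers B u (x, a, e)" using X by (metis stocked_def)
    then obtain p where "mono_path B x p" "length p = a" by (rule offersE)
    then show ?thesis using mono_path_imp_mono_copy by blast
  qed
  then have "builder_forces k (path_graph l) (path_graph c) 0 B"
    using assms by (auto simp: painter_lost_def)
  then show "\<exists>n. builder_forces k (path_graph l) (path_graph c) n B" ..
qed

lemma wins_from_step:
  assumes "1 + (\<Sum>(y, a, e)\<in>#U. e) \<le> K" "K \<le> k"
    and "U = part 1 a e1 + (part 1 b e2 + R1)" "U = part 2 i e3 + (part 2 j e4 + R2)"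
    and win: "wins_from k l c (M + {#(1, a + b + 1, K)#})" "wins_from k l c (M + {#(2, i + j + 1, K)#})"
  shows "wins_from k l c (M + U)"
  unfolding wins_from_def
proof (intro allI impI)
  fix B :: "nat board" assume "stock k B (M + U)"
  then obtain v N where vN: "legal_move k B v N"
    "stock k (add_vertex B v N 1) (M + {#(1, a + b + 1, K)#})"
    "stock k (add_vertex B v N 2) (M + {#(2, i + j + 1, K)#})"
    using stock_move[OF _ assms(1-4)] by metis
  let ?F = "builder_forces k (path_graph l) (path_graph c)"
  obtain n1 n2 where "?F n1 (add_vertex B v N 1)" "?F n2 (add_vertex B v N 2)"
    using win vN(2,3) unfolding wins_from_def by metis
  then have "?F (max n1 n2) (add_vertex B v N 1)" "?F (max n1 n2) (add_vertex B v N 2)"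
    by (meson builder_forces_mono max.cobounded1 max.cobounded2)+
  then have "?F (Suc (max n1 n2)) B" using vN(1) by auto
  then show "\<exists>n. ?F n B" ..
qed

text \<open>One copy of every priced path; the indices start at 1 because empty paths need no
  representative.\<close>

definition base :: "nat list \<Rightarrow> nat list \<Rightarrow> spec multiset" where
  "base rs bs = image_mset (\<lambda>i. (1, i, rs ! i)) (mset_set {1..<length rs}) +
     image_mset (\<lambda>i. (2, i, bs ! i)) (mset_set {1..<length bs})"

lemma base_append:
  assumes "1 \<le> length xs"
  shows "image_mset (\<lambda>i. (x, i, (xs @ [y]) ! i)) (mset_set {1..<length (xs @ [y])}) =
    image_mset (\<lambda>i. (x, i, xs ! i)) (mset_set {1..<length xs}) + {#(x, length xs, y)#}"
proof -
  have "{1..<length (xs @ [y])} = insert (length xs) {1..<length xs}" using assms by auto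
  moreover have "image_mset (\<lambda>i. (x, i, (xs @ [y]) ! i)) (mset_set {1..<length xs}) =
      image_mset (\<lambda>i. (x, i, xs ! i)) (mset_set {1..<length xs})"
    by (intro image_mset_cong) (auto simp: nth_append)
  ultimately show ?thesis by simp
qed

lemma part_subset_base:
  assumes "a < length rs"
  shows "part 1 a (rs ! a) \<subseteq># base rs bs"
  using assms by (auto simp: part_def base_def)

lemma part_2_subset_base:
  assumes "a < length bs"
  shows "part 2 a (bs ! a) \<subseteq># base rs bs"
  using assms by (auto simp: part_def base_def)

lemma repeat_mset_add_mset_mono:
  assumes "n \<le> m" "n \<le> x"
  shows "repeat_mset n (M + {#r#}) \<subseteq># repeat_mset m M + replicate_mset x r"
proof (rule mset_subset_eqI)
  fix z
  have "count (repeat_mset n (M + {#r#})) z = n * count M z + (if z = r then n else 0)"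
    by (simp add: distrib_left)
  also have "\<dots> \<le> m * count M z + (if z = r then x else 0)"
    using assms by (intro add_mono mult_right_mono) auto
  also have "\<dots> = count (repeat_mset m M + replicate_mset x r) z" by simp
  finally show "count (repeat_mset n (M + {#r#})) z \<le> count (repeat_mset m M + replicate_mset x r) z" .
qed

text \<open>Builder plays up to \<open>m\<close> more rounds with the same offer, each of which consumes at most four
  resources; after \<open>n1 + n2\<close> rounds Painter has chosen red \<open>n1\<close> times or blue \<open>n2\<close> times.\<close>

lemma wins_from_pigeonhole:
  assumes "reach rs bs" and K: "K = cost rs bs" "K \<le> k"
    and red: "wins_from k l c (repeat_mset n1 (base rs bs + {#(1, length rs, K)#}))"
    and blue: "wins_from k l c (repeat_mset n2 (base rs bs + {#(2, length bs, K)#}))"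
    and "n1 + n2 \<le> x + y + m"
  shows "wins_from k l c (repeat_mset (n1 + n2 + 4 * m) (base rs bs) +
    replicate_mset x (1, length rs, K) + replicate_mset y (2, length bs, K))"
  using assms(6)
proof (induction m arbitrary: x y)
  case 0
  let ?M = "repeat_mset (n1 + n2 + 4 * 0) (base rs bs)"
  let ?r = "replicate_mset x (1, length rs, K)" and ?b = "replicate_mset y (2, length bs, K)"
  have "n1 \<le> x \<or> n2 \<le> y" using 0 by linarith
  then show ?case
  proof
    assume "n1 \<le> x"
    then have "repeat_mset n1 (base rs bs + {#(1, length rs, K)#}) \<subseteq># ?M + ?r"
      by (intro repeat_mset_add_mset_mono) auto
    also have "\<dots> \<subseteq># ?M + ?r + ?b" by simp
    finally show ?thesis by (rule wins_from_mono[OF red])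
  next
    assume "n2 \<le> y"
    then have "repeat_mset n2 (base rs bs + {#(2, length bs, K)#}) \<subseteq># ?M + ?b"
      by (intro repeat_mset_add_mset_mono) auto
    also have "\<dots> \<subseteq># ?M + ?r + ?b" by simp
    finally show ?thesis by (rule wins_from_mono[OF blue])
  qed
next
  case (Suc m)
  let ?M = "repeat_mset (n1 + n2 + 4 * m) (base rs bs) +
    replicate_mset x (1, length rs, K) + replicate_mset y (2, length bs, K)"
  have len: "1 \<le> length rs" "1 \<le> length bs" and zero: "rs ! 0 = 0" "bs ! 0 = 0"
    using reach_length[OF assms(1)] reach_nth_0[OF assms(1)] by auto
  \<comment> \<open>Optimal splits are offered in both colours, so that the move costs exactly
    \<open>cost rs bs\<close>.\<close>
  obtain a b where ab: "a + b + 1 = length rs" "msum rs (length rs) = rs ! a + rs ! b"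
    using len(1) by (rule msum_attained)
  obtain i j where ij: "i + j + 1 = length bs" "msum bs (length bs) = bs ! i + bs ! j"
    using len(2) by (rule msum_attained)
  let ?R = "part 1 a (rs ! a)" and ?R' = "part 1 b (rs ! b)"
  let ?S = "part 2 i (bs ! i)" and ?S' = "part 2 j (bs ! j)"
  define U where "U = ?R + (?R' + (?S + ?S'))"
  have sum_part: "(\<Sum>(y, a, e)\<in>#part x a e. e) = e" if "a = 0 \<Longrightarrow> e = 0" for x a e
    using that by (simp add: part_def)
  have "(\<Sum>(y, a, e)\<in>#U. e) = rs ! a + (rs ! b + (bs ! i + bs ! j))"
    unfolding U_def image_mset_union sum_mset.union using zero by (simp add: sum_part)
  then have size: "1 + (\<Sum>(y, a, e)\<in>#U. e) \<le> K" using ab ij K by (simp add: cost_def)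
  have U2: "U = ?S + (?S' + (?R + ?R'))" by (simp add: U_def ac_simps)
  have "wins_from k l c (?M + {#(1, a + b + 1, K)#})"
    using Suc.IH[of "Suc x" y] Suc.prems unfolding ab(1) by simp
  moreover have "wins_from k l c (?M + {#(2, i + j + 1, K)#})"
    using Suc.IH[of x "Suc y"] Suc.prems unfolding ij(1) by simp
  ultimately have win: "wins_from k l c (?M + U)"
    by (rule wins_from_step[OF size K(2) U_def U2])
  \<comment> \<open>Each of the at most four resources is taken from a separate copy of
    \<open>base rs bs\<close>.\<close>
  have "U \<subseteq># base rs bs + (base rs bs + (base rs bs + base rs bs))"
    unfolding U_def using ab(1) ij(1)
    by (intro subset_mset.add_mono part_subset_base part_2_subset_base) auto
  also have "\<dots> = repeat_mset 4 (base rs bs)" by (simp add: numeral_eq_Suc)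
  finally have "?M + U \<subseteq># ?M + repeat_mset 4 (base rs bs)" by simp
  also have "\<dots> = repeat_mset (n1 + n2 + 4 * Suc m) (base rs bs) +
    replicate_mset x (1, length rs, K) + replicate_mset y (2, length bs, K)"
    by (rule multiset_eqI) (simp add: algebra_simps)
  finally show ?case by (rule wins_from_mono[OF win])
qed

text \<open>Backward induction over the decisions: both successor states are won from sufficiently
  many copies of their resources, and repeating the current offer produces enough copies for one of
  them. A decision that would price a path with \<open>l\<close> red or \<open>c\<close> blue
  vertices ends the game instead.\<close>

lemma wins_from_reach:
  assumes bound: "\<And>rs bs. reach rs bs \<Longrightarrow> length rs \<le> l \<Longrightarrow> length bs \<le> c \<Longrightarrow> cost rs bs \<le> k"
    and "reach rs bs" "length rs \<le> l" "length bs \<le> c"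
  shows "\<exists>n. wins_from k l c (repeat_mset n (base rs bs))"
  using assms(2-)
proof (induction "(l - length rs) + (c - length bs)" arbitrary: rs bs rule: less_induct)
  case less
  define K where "K = cost rs bs"
  have len: "1 \<le> length rs" "1 \<le> length bs" using reach_length[OF less.prems(1)] by auto
  have K: "K \<le> k" using bound less.prems by (simp add: K_def)
  have r: "base (rs @ [K]) bs = base rs bs + {#(1, length rs, K)#}"
    unfolding base_def base_append[OF len(1)] by (simp add: ac_simps)
  have b: "base rs (bs @ [K]) = base rs bs + {#(2, length bs, K)#}"
    unfolding base_def base_append[OF len(2)] by (simp add: ac_simps)
  have "\<exists>n. wins_from k l c (repeat_mset n (base rs bs + {#(1, length rs, K)#}))"
  proof (cases "length rs < l")
    case True
    then show ?thesis
      unfolding r[symmetric] using reach.red[OF less.prems(1)] less.prems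
      by (intro less.hyps) (auto simp: K_def)
  next
    case False
    then have "wins_from k l c (repeat_mset 1 (base rs bs + {#(1, length rs, K)#}))"
      using less.prems by (intro wins_from_terminal[of l K]) auto
    then show ?thesis ..
  qed
  then obtain n1 where n1: "wins_from k l c (repeat_mset n1 (base rs bs + {#(1, length rs, K)#}))" ..
  have "\<exists>n. wins_from k l c (repeat_mset n (base rs bs + {#(2, length bs, K)#}))"
  proof (cases "length bs < c")
    case True
    then show ?thesis
      unfolding b[symmetric] using reach.blue[OF less.prems(1)] less.prems
      by (intro less.hyps) (auto simp: K_def)
  next
    case False
    then have "wins_from k l c (repeat_mset 1 (base rs bs + {#(2, length bs, K)#}))"
      using less.prems by (intro wins_from_terminal[of l K]) auto
    then show ?thesis ..
  qed
  then obtain n2 where n2: "wins_from k l c (repeat_mset n2 (base rs bs + {#(2, length bs, K)#}))" ..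
  show ?case
    using wins_from_pigeonhole[OF less.prems(1) K_def K n1 n2, of 0 0 "n1 + n2"] by auto
qed

lemma builder_wins_game_value:
  assumes "1 \<le> l" "1 \<le> c"
  shows "builder_wins (game_value l c) (path_graph l) (path_graph c)"
proof -
  have "stock k (empty_board :: nat board) {#}" for k
  proof -
    have "forest (empty_board :: nat board)"
      by (auto simp: forest_def simple_graph_def is_cycle_def empty_board_def intro!: exI[of _ 0])
    moreover have "stocked (empty_board :: nat board) {} s {#}" for s
      by (simp add: stocked_def separated_def)
    ultimately show ?thesis unfolding stock_def by (auto simp: empty_board_def)
  qed
  \<comment> \<open>In the initial state \<open>base\<close> is empty, so the empty board stocks any
    number of copies.\<close>
  moreover obtain n where "wins_from (game_value l c) l c (repeat_mset n (base [0] [0]))"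
    using wins_from_reach[of l c "game_value l c" "[0]" "[0]"] cost_le_game_value reach.start assms
    by auto
  ultimately show ?thesis
    by (auto simp: wins_from_def builder_wins_def base_def)
qed

lemma kstar_eq:
  assumes "1 \<le> l" "1 \<le> c"
  shows "kstar (path_graph l) (path_graph c) = enat (game_value l c)"
proof -
  \<comment> \<open>\<open>kstar\<close> ranges over positive \<open>k\<close> only, so the game
    value has to be shown positive.\<close>
  have "cost [0] [0] \<le> game_value l c" using assms by (intro cost_le_game_value reach.start) auto
  then have "1 \<le> game_value l c" by (simp add: cost_def)
  then have "kstar (path_graph l) (path_graph c) \<le> enat (game_value l c)"
    unfolding kstar_def using builder_wins_game_value[OF assms] by (intro INF_lower) auto
  moreover have "enat (game_value l c) \<le> kstar (path_graph l) (path_graph c)"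
    unfolding kstar_def using game_value_le_of_builder_wins[OF _ assms] by (intro INF_greatest) auto
  ultimately show ?thesis by (rule antisym)
qed

theorem theorem5:
  "\<exists>(\<delta> :: nat \<Rightarrow> real) (\<epsilon> :: nat \<Rightarrow> nat \<Rightarrow> real).
     \<forall>c\<ge>1.
       (\<forall>l\<ge>1. 0 \<le> \<epsilon> c l \<and>
          ereal_of_enat (kstar (path_graph l) (path_graph c)) =
            ereal ((\<delta> c - \<epsilon> c l) * real l)) \<and>
       (\<epsilon> c \<longlonglongrightarrow> 0)"
proof -
  obtain \<delta> where \<delta>: "\<And>c. 1 \<le> c \<Longrightarrow>
      (\<forall>l\<ge>1. real (game_value l c) \<le> \<delta> c * real l) \<and>
      (\<lambda>l. \<delta> c - real (game_value l c) / real l) \<longlonglongrightarrow> 0"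
    using game_value_asymptotics by metis
  \<comment> \<open>The error is the gap between the constant and the ratio, so its sign is the
    upper bound valid for every \<open>l \<ge> 1\<close>.\<close>
  define \<epsilon> where "\<epsilon> c l = \<delta> c - real (game_value l c) / real l" for c l
  have "0 \<le> \<epsilon> c l \<and> ereal_of_enat (kstar (path_graph l) (path_graph c)) =
      ereal ((\<delta> c - \<epsilon> c l) * real l)" if "1 \<le> c" "1 \<le> l" for c l
    using \<delta>[OF that(1)] that kstar_eq[OF that(2,1)] by (auto simp: \<epsilon>_def divide_le_eq)
  moreover have "\<epsilon> c \<longlonglongrightarrow> 0" if "1 \<le> c" for c
    using \<delta>[OF that] unfolding \<epsilon>_def by blast
  ultimately show ?thesis by blast
qed

end
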